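(* There is an absolute constant $C>0$ such that the following holds. Suppose that $p$ is prime, $A$ is a $1\times m$ matrix with entries in $\mathbb{Z}/p\mathbb{Z}$ that satisfies the columns condition over $\mathbb{Z}/p\mathbb{Z}$, and $(\mathbb{Z}/p\mathbb{Z})^*=(\mathbb{Z}/p\mathbb{Z})\setminus\{0\}$ is $r$-coloured in such a way that there is no monochromatic solution to $Ax=0$. Then $p\le \exp((2r)^{C})$.
   Context: A matrix $A$ over a field $\mathbb{F}$ satisfies the columns condition over $\mathbb{F}$ if there is a partition $\{P_1,\dots,P_d\}$ of the (index set of the) columns of $A$ such that for every $1\le j\le d$, $\sum_{c\in P_j} c$ lies in the $\mathbb{F}$-span of the columns in $P_1\cup\dots\cup P_{j-1}$ (this span being the zero space when $j=1$). An $r$-colouring is a map to $\{1,\dots,r\}$. A monochromatic solution to $Ax=0$ is a vector $x=(x_1,\dots,x_m)$ with $Ax=0$ whose entries all lie in $(\mathbb{Z}/p\mathbb{Z})^*$ and all receive the same colour. *)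

theory Defs
  imports Complex_Main "HOL-Library.Disjoint_Sets" "HOL-Number_Theory.Residues"
begin

text \<open>
  The ring is a parameter, and not a type, so that a statement may quantify over the prime $p$
  (with the ring \<^term>\<open>residue_ring (int p)\<close>) inside the scope of an absolute constant.
  An $n \times m$ matrix is a function of a row index in \<open>{1..n}\<close> and a column index in
  \<open>{1..m}\<close>; its values at other indices are never used. Vectors of length $n$ are
  functions that are \<open>undefined\<close> outside \<open>{1..n}\<close>, so that equality of such functions
  is equality of vectors.
\<close>

definition matrix_over ::
    "('a, 'b) ring_scheme \<Rightarrow> nat \<Rightarrow> nat \<Rightarrow> (nat \<Rightarrow> nat \<Rightarrow> 'a) \<Rightarrow> bool" where
  "matrix_over R n m A \<longleftrightarrow> (\<forall>i\<in>{1..n}. \<forall>j\<in>{1..m}. A i j \<in> carrier R)"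

definition column_sum ::
    "('a, 'b) ring_scheme \<Rightarrow> nat \<Rightarrow> (nat \<Rightarrow> nat \<Rightarrow> 'a) \<Rightarrow> nat set \<Rightarrow> nat \<Rightarrow> 'a" where
  "column_sum R n A S = (\<lambda>i\<in>{1..n}. \<Oplus>\<^bsub>R\<^esub>j\<in>S. A i j)"

definition column_span ::
    "('a, 'b) ring_scheme \<Rightarrow> nat \<Rightarrow> (nat \<Rightarrow> nat \<Rightarrow> 'a) \<Rightarrow> nat set \<Rightarrow> (nat \<Rightarrow> 'a) set" where
  "column_span R n A S =
     {(\<lambda>i\<in>{1..n}. \<Oplus>\<^bsub>R\<^esub>j\<in>S. c j \<otimes>\<^bsub>R\<^esub> A i j) | c. c \<in> S \<rightarrow> carrier R}"

text \<open>
  The cells are numbered $P_1, \dots, P_d$ without repetition. For $j = 1$ the span is that of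
  the empty family, which is $\{0\}$.
\<close>

definition columns_condition ::
    "('a, 'b) ring_scheme \<Rightarrow> nat \<Rightarrow> nat \<Rightarrow> (nat \<Rightarrow> nat \<Rightarrow> 'a) \<Rightarrow> bool" where
  "columns_condition R n m A \<longleftrightarrow>
     (\<exists>(d::nat) (P::nat \<Rightarrow> nat set). inj_on P {1..d} \<and> partition_on {1..m} (P ` {1..d}) \<and>
        (\<forall>j\<in>{1..d}. column_sum R n A (P j) \<in> column_span R n A (\<Union>k\<in>{1..<j}. P k)))"

definition solution ::
    "('a, 'b) ring_scheme \<Rightarrow> nat \<Rightarrow> nat \<Rightarrow> (nat \<Rightarrow> nat \<Rightarrow> 'a) \<Rightarrow> (nat \<Rightarrow> 'a) \<Rightarrow> bool" where
  "solution R n m A x \<longleftrightarrow>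
     x \<in> {1..m} \<rightarrow> carrier R \<and>
     (\<forall>i\<in>{1..n}. (\<Oplus>\<^bsub>R\<^esub>j\<in>{1..m}. A i j \<otimes>\<^bsub>R\<^esub> x j) = \<zero>\<^bsub>R\<^esub>)"

definition colouring ::
    "('a, 'b) ring_scheme \<Rightarrow> nat \<Rightarrow> ('a \<Rightarrow> nat) \<Rightarrow> bool" where
  "colouring R r f \<longleftrightarrow> f \<in> carrier R - {\<zero>\<^bsub>R\<^esub>} \<rightarrow> {1..r}"

definition monochromatic_solution ::
    "('a, 'b) ring_scheme \<Rightarrow> nat \<Rightarrow> nat \<Rightarrow> (nat \<Rightarrow> nat \<Rightarrow> 'a) \<Rightarrow> ('a \<Rightarrow> nat) \<Rightarrow> (nat \<Rightarrow> 'a) \<Rightarrow> bool" where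
  "monochromatic_solution R n m A f x \<longleftrightarrow>
     solution R n m A x \<and> (\<forall>j\<in>{1..m}. x j \<noteq> \<zero>\<^bsub>R\<^esub>) \<and>
     (\<exists>c. \<forall>j\<in>{1..m}. f (x j) = c)"

end

theory Submission imports Defs "HOL-Analysis.Convex"
begin

text \<open>
  If not all columns vanish, the columns condition for a single equation provides a set \<open>S\<close> of
  columns with sum zero that contains a nonzero column. Putting \<open>x\<close> on \<open>S\<close> except \<open>z\<close> at that
  column, and \<open>y\<close> off \<open>S\<close>, reduces the problem to \<open>z = x + c y\<close> with \<open>c \<noteq> 0\<close> (the case \<open>c = 0\<close>
  has constant solutions).

  Suppose that no class \<open>A\<^sub>i\<close> contains a solution. For a Bohr set \<open>B\<close> consider the sum over \<open>i\<close> of the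
  largest density of \<open>A\<^sub>i\<close> on a translate of \<open>B\<close>; it is at most \<open>r\<close>, and it barely drops when \<open>B\<close>
  is replaced by a much smaller Bohr set inside it. Take a smaller Bohr set \<open>S\<close>. By pigeonhole some
  \<open>c A\<^sub>i\<close> has density at least \<open>1/(2r)\<close> in \<open>S\<close>. Either \<open>A\<^sub>i\<close> is sparse on the translates of \<open>B\<close>, and then
  passing into \<open>c\<^bsup>-1\<^esup>S\<close> raises the sum, or the dense set \<open>S \<inter> c A\<^sub>i\<close> misses \<open>A\<^sub>i - A\<^sub>i\<close>, and then a
  local Fourier argument raises the density of \<open>A\<^sub>i\<close> on a Bohr set with \<open>O(r\<^sup>3)\<close> further
  frequencies. Each step gains at least a constant times \<open>r\<^bsup>-2\<^esup>\<close>, so there are \<open>O(r\<^sup>3)\<close> steps, after which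
  the Bohr sets still have rank polynomial in \<open>r\<close> and radius \<open>exp (- poly r)\<close>; they are
  nontrivial unless \<open>p \<le> exp (poly r)\<close>.
\<close>

section \<open>Counting periodic sets of integers\<close>

text \<open>Subsets of Z/pZ are modelled as \<open>p\<close>-periodic sets of integers, counted
  through their representatives in \<open>{0..<int p}\<close>. The count is real so that densities
  are plain quotients.\<close>

definition cnt :: "nat \<Rightarrow> int set \<Rightarrow> real" where
  "cnt p X = real (card (X \<inter> {0..<int p}))"

definition periodic :: "nat \<Rightarrow> (int \<Rightarrow> 'a) \<Rightarrow> bool" where
  "periodic p F \<longleftrightarrow> (\<forall>x y. [x = y] (mod int p) \<longrightarrow> F x = F y)"

abbreviation periodic_set :: "nat \<Rightarrow> int set \<Rightarrow> bool" where
  "periodic_set p X \<equiv> periodic p (\<lambda>x. x \<in> X)"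

lemma periodicD: "periodic p F \<Longrightarrow> [x = y] (mod int p) \<Longrightarrow> F x = F y"
  by (simp add: periodic_def)

lemma periodic_mod: "periodic p F \<Longrightarrow> F (x mod int p) = F x"
  by (erule periodicD) (simp add: cong_def)

lemma periodic_Int [intro]:
  "periodic_set p X \<Longrightarrow> periodic_set p Y \<Longrightarrow> periodic_set p (X \<inter> Y)"
  by (simp add: periodic_def)

lemma periodic_shift [intro]: "periodic_set p X \<Longrightarrow> periodic_set p {x. x - t \<in> X}"
  unfolding periodic_def by (auto dest: cong_diff[OF _ cong_refl[of t]])

lemma cnt_eq_sum: "cnt p X = (\<Sum>x\<in>{0..<int p}. of_bool (x \<in> X))"
proof -
  have "(\<Sum>x\<in>{0..<int p}. of_bool (x \<in> X)) = (\<Sum>x\<in>{0..<int p}. if x \<in> X then 1 else (0::real))"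
    by (intro sum.cong) auto
  also have "\<dots> = real (card ({0..<int p} \<inter> X))"
    by (simp add: sum.If_cases)
  finally show ?thesis by (simp add: cnt_def Int_commute)
qed

lemma cnt_nonneg [simp]: "0 \<le> cnt p X" by (simp add: cnt_def)

lemma cnt_mono: "(\<And>x. x \<in> X \<Longrightarrow> x \<in> Y) \<Longrightarrow> cnt p X \<le> cnt p Y"
  unfolding cnt_def of_nat_le_iff by (rule card_mono) auto

text \<open>Reduced modulo \<open>p\<close>, the map \<open>h\<close> is an injection of the finite
  set of representatives into itself, hence a permutation. Translation, reflection and dilation are
  the instances used.\<close>

lemma sum_reindex_mod:
  fixes F :: "int \<Rightarrow> 'a::comm_monoid_add"
  assumes "p > 0" "periodic p F"
    and inj: "\<And>x y. [h x = h y] (mod int p) \<Longrightarrow> [x = y] (mod int p)"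
  shows "(\<Sum>x\<in>{0..<int p}. F (h x)) = (\<Sum>x\<in>{0..<int p}. F x)"
proof -
  let ?I = "{0..<int p}" and ?g = "\<lambda>x. h x mod int p"
  have inj': "inj_on ?g ?I"
  proof (rule inj_onI)
    fix x y assume "x \<in> ?I" "y \<in> ?I" "h x mod int p = h y mod int p"
    thus "x = y" using inj[of x y] by (simp add: cong_def)
  qed
  have "?g ` ?I \<subseteq> ?I" using \<open>p > 0\<close> by auto
  hence "?g ` ?I = ?I" using inj' by (intro endo_inj_surj) auto
  hence "(\<Sum>x\<in>?I. F x) = (\<Sum>x\<in>?g ` ?I. F x)" by simp
  also have "\<dots> = (\<Sum>x\<in>?I. F (?g x))" using inj' by (simp add: sum.reindex)
  also have "\<dots> = (\<Sum>x\<in>?I. F (h x))" using assms(2) by (simp add: periodic_mod)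
  finally show ?thesis by simp
qed

lemma sum_shift_mod:
  fixes F :: "int \<Rightarrow> 'a::comm_monoid_add"
  assumes "p > 0" "periodic p F"
  shows "(\<Sum>x\<in>{0..<int p}. F (x + t)) = (\<Sum>x\<in>{0..<int p}. F x)"
  using assms by (rule sum_reindex_mod) (simp add: cong_add_rcancel)

lemma sum_reflect_mod:
  fixes F :: "int \<Rightarrow> 'a::comm_monoid_add"
  assumes "p > 0" "periodic p F"
  shows "(\<Sum>x\<in>{0..<int p}. F (t - x)) = (\<Sum>x\<in>{0..<int p}. F x)"
proof (rule sum_reindex_mod[OF assms])
  fix x y assume "[t - x = t - y] (mod int p)"
  from cong_diff[OF cong_refl[of t] this] show "[x = y] (mod int p)" by simp
qed

lemma sum_mult_mod:
  fixes F :: "int \<Rightarrow> 'a::comm_monoid_add"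
  assumes "p > 0" "periodic p F" "coprime c (int p)"
  shows "(\<Sum>x\<in>{0..<int p}. F (c * x)) = (\<Sum>x\<in>{0..<int p}. F x)"
  using assms(1,2) by (rule sum_reindex_mod) (use assms(3) in \<open>simp add: cong_mult_lcancel\<close>)

lemma periodic_of_bool: "periodic_set p X \<Longrightarrow> periodic p (\<lambda>x. of_bool (x \<in> X))"
  by (simp add: periodic_def)

lemma cnt_shift:
  assumes "p > 0" "periodic_set p X"
  shows "cnt p {x. x - t \<in> X} = cnt p X"
  unfolding cnt_eq_sum mem_Collect_eq diff_conv_add_uminus
  by (rule sum_shift_mod[OF assms(1) periodic_of_bool[OF assms(2)]])

text \<open>Double counting: a fixed \<open>y\<close> in \<open>X\<close> lies in the translate of
  \<open>T\<close> by \<open>x\<close> exactly when \<open>x\<close> is in \<open>y - T\<close>,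
  which has as many residues as \<open>T\<close>.\<close>

lemma sum_cnt_shift:
  assumes "p > 0" "periodic_set p T"
  shows "(\<Sum>x\<in>{0..<int p}. cnt p (X \<inter> {y. y - x \<in> T})) = cnt p X * cnt p T"
proof -
  let ?I = "{0..<int p}"
  have "(\<Sum>x\<in>?I. cnt p (X \<inter> {y. y - x \<in> T}))
      = (\<Sum>x\<in>?I. \<Sum>y\<in>?I. of_bool (y \<in> X) * of_bool (y - x \<in> T))"
    by (simp add: cnt_eq_sum of_bool_conj)
  also have "\<dots> = (\<Sum>y\<in>?I. \<Sum>x\<in>?I. of_bool (y \<in> X) * of_bool (y - x \<in> T))"
    by (rule sum.swap)
  also have "\<dots> = (\<Sum>y\<in>?I. of_bool (y \<in> X) * (\<Sum>x\<in>?I. of_bool (y - x \<in> T)))"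
    by (simp only: sum_distrib_left)
  also have "\<dots> = (\<Sum>y\<in>?I. of_bool (y \<in> X) * cnt p T)"
    unfolding cnt_eq_sum
    by (simp only: sum_reflect_mod[OF assms(1) periodic_of_bool[OF assms(2)]])
  also have "\<dots> = cnt p X * cnt p T"
    by (simp add: cnt_eq_sum sum_distrib_right)
  finally show ?thesis .
qed

section \<open>Largest density on a translate\<close>

definition tdens :: "nat \<Rightarrow> int set \<Rightarrow> int set \<Rightarrow> real" where
  "tdens p A B = Max ((\<lambda>t. cnt p (A \<inter> {x. x - t \<in> B}) / cnt p B) ` {0..<int p})"

lemma tdens_ge:
  assumes "p > 0" "periodic_set p B"
  shows "cnt p (A \<inter> {x. x - t \<in> B}) / cnt p B \<le> tdens p A B"
proof -
  have "x - t mod int p \<in> B \<longleftrightarrow> x - t \<in> B" for x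
    using assms(2) by (rule periodicD) (simp add: cong_def mod_simps)
  hence "cnt p (A \<inter> {x. x - t \<in> B}) / cnt p B
      = cnt p (A \<inter> {x. x - (t mod int p) \<in> B}) / cnt p B" by simp
  also have "\<dots> \<le> tdens p A B"
    unfolding tdens_def using assms(1) by (intro Max_ge) auto
  finally show ?thesis .
qed

lemma tdens_attained:
  assumes "p > 0"
  obtains t where "tdens p A B = cnt p (A \<inter> {x. x - t \<in> B}) / cnt p B"
proof -
  have "tdens p A B \<in> (\<lambda>t. cnt p (A \<inter> {x. x - t \<in> B}) / cnt p B) ` {0..<int p}"
    unfolding tdens_def using assms by (intro Max_in) auto
  thus ?thesis using that by auto
qed

lemma tdens_nonneg: "p > 0 \<Longrightarrow> 0 \<le> tdens p A B"
  by (rule tdens_attained[of p A B]) auto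

lemma tdens_le_1:
  assumes "p > 0" "periodic_set p B"
  shows "tdens p A B \<le> 1"
proof -
  obtain t where t: "tdens p A B = cnt p (A \<inter> {x. x - t \<in> B}) / cnt p B"
    using tdens_attained[OF assms(1)] .
  have "cnt p (A \<inter> {x. x - t \<in> B}) \<le> cnt p {x. x - t \<in> B}" by (rule cnt_mono) auto
  also have "\<dots> = cnt p B" by (rule cnt_shift[OF assms])
  finally show ?thesis unfolding t using cnt_nonneg[of p B]
    by (simp add: divide_le_eq_1 less_le)
qed

text \<open>Averaging: the translates of \<open>B'\<close> cover the part of \<open>A\<close> in the
  best translate \<open>t + B\<close> uniformly. Only translates by points of \<open>t + D\<close>
  meet that part, each in at most \<open>tdens p A B' * cnt p B'\<close> points, and
  \<open>D\<close> is hardly larger than \<open>B\<close>.\<close>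

lemma tdens_mono:
  assumes p: "p > 0" and per: "periodic_set p B'" "periodic_set p D"
    and sum: "\<And>x y. x \<in> B \<Longrightarrow> y \<in> B' \<Longrightarrow> x - y \<in> D"
    and D: "cnt p D \<le> (1 + e) * cnt p B" and pos: "cnt p B > 0" "cnt p B' > 0"
  shows "tdens p A B \<le> (1 + e) * tdens p A B'"
proof -
  let ?I = "{0..<int p}"
  obtain t where t: "tdens p A B = cnt p (A \<inter> {x. x - t \<in> B}) / cnt p B"
    using tdens_attained[OF p] .
  define A' where "A' = A \<inter> {x. x - t \<in> B}"
  have "cnt p A' * cnt p B' = (\<Sum>x\<in>?I. cnt p (A' \<inter> {y. y - x \<in> B'}))"
    by (rule sum_cnt_shift[symmetric, OF p per(1)])
  also have "\<dots> \<le> (\<Sum>x\<in>?I. of_bool (x \<in> {x. x - t \<in> D}) * (tdens p A B' * cnt p B'))"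
  proof (rule sum_mono)
    fix x
    show "cnt p (A' \<inter> {y. y - x \<in> B'}) \<le> of_bool (x \<in> {x. x - t \<in> D}) * (tdens p A B' * cnt p B')"
    proof (cases "x - t \<in> D")
      case True
      have "cnt p (A' \<inter> {y. y - x \<in> B'}) \<le> cnt p (A \<inter> {y. y - x \<in> B'})"
        by (rule cnt_mono) (auto simp: A'_def)
      also have "\<dots> \<le> tdens p A B' * cnt p B'"
        using tdens_ge[OF p per(1), of A x] pos by (simp add: divide_le_eq)
      finally show ?thesis using True by simp
    next
      case False
      have "A' \<inter> {y. y - x \<in> B'} = {}"
      proof (rule ccontr)
        assume "A' \<inter> {y. y - x \<in> B'} \<noteq> {}"
        then obtain y where "y - t \<in> B" "y - x \<in> B'" by (auto simp: A'_def)
        from sum[OF this] have "x - t \<in> D" by simp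
        with False show False ..
      qed
      thus ?thesis using False by (simp add: cnt_def)
    qed
  qed
  also have "\<dots> = cnt p {x. x - t \<in> D} * (tdens p A B' * cnt p B')"
    by (simp add: cnt_eq_sum sum_distrib_right)
  also have "\<dots> = cnt p D * (tdens p A B' * cnt p B')"
    by (simp add: cnt_shift[OF p per(2)])
  also have "\<dots> \<le> (1 + e) * cnt p B * (tdens p A B' * cnt p B')"
    using D by (intro mult_right_mono) (auto simp: tdens_nonneg[OF p])
  finally have "cnt p A' \<le> (1 + e) * cnt p B * tdens p A B'"
    using pos by simp
  thus ?thesis using pos unfolding t A'_def[symmetric] by (simp add: divide_le_eq mult_ac)
qed

section \<open>Characters\<close>

text \<open>The standard additive character of Z/pZ; the character of frequency \<open>k\<close> is
  \<open>ch p (k * x)\<close> as a function of \<open>x\<close>.\<close>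

definition ch :: "nat \<Rightarrow> int \<Rightarrow> complex" where
  "ch p k = cis (2 * pi * (real_of_int k / real p))"

lemma ch_0 [simp]: "ch p 0 = 1" by (simp add: ch_def)

lemma ch_add: "ch p (k + l) = ch p k * ch p l"
  by (simp add: ch_def cis_mult add_divide_distrib distrib_left)

lemma norm_ch [simp]: "norm (ch p k) = 1" by (simp add: ch_def)

lemma cnj_ch: "cnj (ch p k) = ch p (- k)" by (simp add: ch_def cis_cnj)

lemma ch_diff: "ch p (k - l) = ch p k * ch p (- l)"
  using ch_add[of p k "- l"] by simp

lemma ch_eq_1_iff:
  assumes "p > 0"
  shows "ch p k = 1 \<longleftrightarrow> int p dvd k"
proof
  assume "ch p k = 1"
  hence "cos (2 * pi * (real_of_int k / real p)) = 1" by (simp add: ch_def complex_eq_iff)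
  then obtain n :: int where "2 * pi * (real_of_int k / real p) = n * 2 * pi"
    by (auto simp: cos_one_2pi_int)
  hence "real_of_int k = real_of_int (n * int p)" using assms by (simp add: field_simps)
  hence "k = n * int p" by (simp only: of_int_eq_iff)
  thus "int p dvd k" by simp
next
  assume "int p dvd k"
  then obtain n where "k = int p * n" by auto
  hence "ch p k = cis (2 * pi * real_of_int n)" using assms by (simp add: ch_def)
  thus "ch p k = 1" by simp
qed

lemma periodic_ch: "p > 0 \<Longrightarrow> periodic p (ch p)"
  unfolding periodic_def
proof safe
  fix x y assume "p > 0" "[x = y] (mod int p)"
  hence "ch p (x - y) = 1" by (simp add: ch_eq_1_iff cong_iff_dvd_diff)
  thus "ch p x = ch p y" using ch_add[of p "x - y" y] by simp
qed

lemma periodic_ch_mult: "p > 0 \<Longrightarrow> periodic p (\<lambda>x. ch p (k * x))"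
  using periodic_ch[of p] unfolding periodic_def by (simp add: cong_mult)

text \<open>Orthogonality of characters. Replacing \<open>x\<close> by \<open>x + 1\<close>
  multiplies the sum by \<open>ch p k\<close>, so it vanishes unless this factor is 1.\<close>

lemma sum_ch:
  assumes "p > 0"
  shows "(\<Sum>x\<in>{0..<int p}. ch p (k * x)) = (if int p dvd k then of_nat p else 0)"
proof (cases "int p dvd k")
  case True
  hence "ch p (k * x) = 1" for x using assms by (simp add: ch_eq_1_iff)
  thus ?thesis using True by simp
next
  case False
  let ?S = "\<Sum>x\<in>{0..<int p}. ch p (k * x)"
  have "?S = (\<Sum>x\<in>{0..<int p}. ch p (k * (x + 1)))"
    by (rule sum_shift_mod[symmetric, OF assms periodic_ch_mult[OF assms]])
  also have "\<dots> = ?S * ch p k" by (simp add: distrib_left ch_add sum_distrib_right)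
  finally show ?thesis using False by (simp add: ch_eq_1_iff[OF assms])
qed

text \<open>Expanding the square and summing over \<open>k\<close> first leaves only the diagonal,
  by orthogonality.\<close>

lemma parseval:
  assumes "p > 0"
  shows "(\<Sum>k\<in>{0..<int p}. (norm (\<Sum>x\<in>{0..<int p}. F x * ch p (k * x)))\<^sup>2)
       = real p * (\<Sum>x\<in>{0..<int p}. (norm (F x))\<^sup>2)"
proof -
  let ?I = "{0..<int p}"
  have dvd: "int p dvd x - y \<longleftrightarrow> x = y" if "x \<in> ?I" "y \<in> ?I" for x y
    using that by (simp add: cong_iff_dvd_diff[symmetric] cong_def)
  have key: "ch p ((x - y) * k) = ch p (k * x) * ch p (- (k * y))" for x y k
    by (simp add: ch_diff[symmetric] algebra_simps)
  have "complex_of_real (\<Sum>k\<in>?I. (norm (\<Sum>x\<in>?I. F x * ch p (k * x)))\<^sup>2)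
      = (\<Sum>k\<in>?I. (\<Sum>x\<in>?I. F x * ch p (k * x)) * (\<Sum>y\<in>?I. cnj (F y) * ch p (- (k * y))))"
    by (simp add: complex_norm_square cnj_ch del: of_real_power)
  also have "\<dots> = (\<Sum>k\<in>?I. \<Sum>x\<in>?I. \<Sum>y\<in>?I. F x * cnj (F y) * ch p ((x - y) * k))"
    unfolding key sum_product by (simp add: mult_ac)
  also have "\<dots> = (\<Sum>x\<in>?I. \<Sum>k\<in>?I. \<Sum>y\<in>?I. F x * cnj (F y) * ch p ((x - y) * k))"
    by (rule sum.swap)
  also have "\<dots> = (\<Sum>x\<in>?I. \<Sum>y\<in>?I. F x * cnj (F y) * (\<Sum>k\<in>?I. ch p ((x - y) * k)))"
    by (subst sum.swap) (simp add: sum_distrib_left)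
  also have "\<dots> = (\<Sum>x\<in>?I. \<Sum>y\<in>?I. if x = y then F x * cnj (F y) * of_nat p else 0)"
    by (intro sum.cong refl) (simp add: sum_ch[OF assms] dvd)
  also have "\<dots> = (\<Sum>x\<in>?I. of_nat p * (F x * cnj (F x)))"
    by (simp add: mult_ac)
  also have "\<dots> = complex_of_real (real p * (\<Sum>x\<in>?I. (norm (F x))\<^sup>2))"
    by (simp add: complex_norm_square sum_distrib_left del: of_real_power)
  finally show ?thesis by (simp only: of_real_eq_iff)
qed

text \<open>The correlation of \<open>X\<close> with \<open>C\<close> moves little in mean square
  under the shift by \<open>s\<close>: the transform of the difference is that of \<open>X\<close>
  times a factor of norm at most \<open>d\<close>, by \<open>spec\<close>. Parseval is applied once
  to the difference and once, backwards, to \<open>X\<close>.\<close>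

lemma almost_periodic:
  fixes s :: int
  assumes p: "p > 0" and per: "periodic_set p X" and c: "0 \<le> d"
    and spec: "\<And>k. norm (\<Sum>y\<in>C. ch p (k * y)) * norm (ch p (k * s) - 1) \<le> d"
  shows "(\<Sum>x\<in>{0..<int p}. ((\<Sum>y\<in>C. of_bool (x + s + y \<in> X)) - (\<Sum>y\<in>C. of_bool (x + y \<in> X)))\<^sup>2)
    \<le> d\<^sup>2 * cnt p X"
proof -
  let ?I = "{0..<int p}"
  define D :: "int \<Rightarrow> real" where
    "D x = (\<Sum>y\<in>C. of_bool (x + s + y \<in> X)) - (\<Sum>y\<in>C. of_bool (x + y \<in> X))" for x
  define H where "H k = (\<Sum>x\<in>?I. of_bool (x \<in> X) * ch p (k * x))" for k
  have shift: "(\<Sum>x\<in>?I. of_bool (x + t \<in> X) * ch p (k * x)) = ch p (- k * t) * H k" for t k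
  proof -
    let ?F = "\<lambda>x. of_bool (x \<in> X) * ch p (k * (x - t))"
    have "periodic p ?F"
      unfolding periodic_def
    proof (intro allI impI)
      fix x y assume xy: "[x = y] (mod int p)"
      hence "[k * (x - t) = k * (y - t)] (mod int p)" by (intro cong_mult cong_diff cong_refl)
      from periodicD[OF periodic_ch[OF p] this] periodicD[OF per xy] show "?F x = ?F y" by simp
    qed
    from sum_shift_mod[OF p this, of t]
    have "(\<Sum>x\<in>?I. of_bool (x + t \<in> X) * ch p (k * x)) = (\<Sum>x\<in>?I. of_bool (x \<in> X) * ch p (k * (x - t)))"
      by simp
    also have "\<dots> = ch p (- k * t) * H k"
      unfolding H_def sum_distrib_left
    proof (rule sum.cong)
      fix x
      have "ch p (k * (x - t)) = ch p (- k * t) * ch p (k * x)"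
        by (simp add: ch_add[symmetric] algebra_simps)
      thus "of_bool (x \<in> X) * ch p (k * (x - t)) = ch p (- k * t) * (of_bool (x \<in> X) * ch p (k * x))"
        by simp
    qed simp
    finally show ?thesis .
  qed
  have ob: "complex_of_real (of_bool b) = of_bool b" for b by simp
  have four: "(\<Sum>x\<in>?I. complex_of_real (D x) * ch p (k * x))
      = H k * ((\<Sum>y\<in>C. ch p ((- k) * y)) * (ch p ((- k) * s) - 1))" for k
  proof -
    have "(\<Sum>x\<in>?I. complex_of_real (D x) * ch p (k * x))
      = (\<Sum>x\<in>?I. \<Sum>y\<in>C. of_bool (x + (s + y) \<in> X) * ch p (k * x))
       - (\<Sum>x\<in>?I. \<Sum>y\<in>C. of_bool (x + y \<in> X) * ch p (k * x))"
      unfolding D_def by (simp only: of_real_diff of_real_sum ob sum_distrib_right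
        left_diff_distrib sum_subtractf add.assoc)
    also have "\<dots> = (\<Sum>y\<in>C. ch p (- k * (s + y)) * H k) - (\<Sum>y\<in>C. ch p (- k * y) * H k)"
      by (subst (1 2) sum.swap) (simp only: shift)
    also have "\<dots> = H k * ((\<Sum>y\<in>C. ch p ((- k) * y)) * (ch p ((- k) * s) - 1))"
      unfolding distrib_left[of "- k"] ch_add
      by (simp add: sum_distrib_left sum_distrib_right right_diff_distrib sum_subtractf mult_ac)
    finally show ?thesis .
  qed
  have "real p * (\<Sum>x\<in>?I. (D x)\<^sup>2) = real p * (\<Sum>x\<in>?I. (norm (complex_of_real (D x)))\<^sup>2)"
    by simp
  also have "\<dots> = (\<Sum>k\<in>?I. (norm (\<Sum>x\<in>?I. complex_of_real (D x) * ch p (k * x)))\<^sup>2)"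
    by (rule parseval[OF p, symmetric])
  also have "\<dots> = (\<Sum>k\<in>?I. (norm (H k))\<^sup>2 * (norm (\<Sum>y\<in>C. ch p ((- k) * y)) * norm (ch p ((- k) * s) - 1))\<^sup>2)"
    by (simp only: four norm_mult power_mult_distrib)
  also have "\<dots> \<le> (\<Sum>k\<in>?I. (norm (H k))\<^sup>2 * d\<^sup>2)"
    by (intro sum_mono mult_left_mono power_mono spec) auto
  also have "\<dots> = d\<^sup>2 * (\<Sum>k\<in>?I. (norm (H k))\<^sup>2)"
    by (simp add: sum_distrib_left mult_ac)
  also have "(\<Sum>k\<in>?I. (norm (H k))\<^sup>2) = real p * (\<Sum>x\<in>?I. (norm (of_bool (x \<in> X) :: complex))\<^sup>2)"
    unfolding H_def by (rule parseval[OF p])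
  also have "(\<Sum>x\<in>?I. (norm (of_bool (x \<in> X) :: complex))\<^sup>2) = cnt p X"
    unfolding cnt_eq_sum by (intro sum.cong) auto
  finally have "real p * (\<Sum>x\<in>?I. (D x)\<^sup>2) \<le> real p * (d\<^sup>2 * cnt p X)" by (simp add: mult_ac)
  hence "(\<Sum>x\<in>?I. (D x)\<^sup>2) \<le> d\<^sup>2 * cnt p X" using p by simp
  thus ?thesis by (simp add: D_def)
qed

section \<open>Density increment\<close>

text \<open>Cauchy-Schwarz turns the mean square bound of \<open>almost_periodic\<close> into a
  bound for a correlation with \<open>X\<close>.\<close>

lemma sum_indicator_le:
  assumes p: "p > 0" and d: "0 \<le> d" and b: "(\<Sum>x\<in>{0..<int p}. (F x)\<^sup>2) \<le> d\<^sup>2 * cnt p X"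
  shows "(\<Sum>x\<in>{0..<int p}. of_bool (x \<in> X) * F x) \<le> d * cnt p X"
proof (rule power2_le_imp_le)
  have "(\<Sum>x\<in>{0..<int p}. of_bool (x \<in> X) * F x)\<^sup>2
      \<le> (\<Sum>x\<in>{0..<int p}. (of_bool (x \<in> X))\<^sup>2) * (\<Sum>x\<in>{0..<int p}. (F x)\<^sup>2)"
    by (rule Cauchy_Schwarz_ineq_sum)
  also have "(\<Sum>x\<in>{0..<int p}. (of_bool (x \<in> X))\<^sup>2) = cnt p X"
    unfolding cnt_eq_sum by (intro sum.cong) auto
  also have "cnt p X * (\<Sum>x\<in>{0..<int p}. (F x)\<^sup>2) \<le> cnt p X * (d\<^sup>2 * cnt p X)"
    by (intro mult_left_mono b) auto
  finally show "(\<Sum>x\<in>{0..<int p}. of_bool (x \<in> X) * F x)\<^sup>2 \<le> (d * cnt p X)\<^sup>2"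
    by (simp add: power2_eq_square mult_ac)
qed (use d in simp)

text \<open>The numerical contradiction behind the density increment: \<open>a\<close> and
  \<open>b\<close> are the densities on the old and the new set, \<open>h\<close> the regularity
  loss and \<open>e\<close> the almost-periodicity error. For \<open>b = a\<close> and
  \<open>h = 0\<close> the right side is \<open>a^2\<close>; the slack in \<open>b\<close> and
  \<open>h\<close> costs \<open>a^2 / 8\<close> each, and the left side is at most
  \<open>a^2 / 2\<close>.\<close>

lemma increment_arith:
  fixes a b e h :: real
  assumes "0 < a" "a \<le> 1" "0 \<le> h" "h \<le> a\<^sup>2 / 8" "e \<le> a / 2" "b < a + a\<^sup>2 / 8" "0 \<le> b"
  shows "e * a < b * a - b * (1 + h) + a"
proof -
  have a2: "a\<^sup>2 \<le> a" "0 < a\<^sup>2" using assms by (simp_all add: power2_eq_square mult_left_le)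
  have "b * (1 + h - a) \<le> (a + a\<^sup>2 / 8) * (1 + h - a)"
    using assms a2 by (intro mult_right_mono) auto
  also have "\<dots> = a * (1 + h - a) + a\<^sup>2 / 8 * (1 + h - a)" by (simp add: algebra_simps)
  also have "a\<^sup>2 / 8 * (1 + h - a) \<le> a\<^sup>2 / 8 * 1"
    using assms a2 by (intro mult_left_mono) auto
  also have "a * (1 + h - a) = a - a\<^sup>2 + a * h" by (simp add: algebra_simps power2_eq_square)
  also have "a * h \<le> 1 * (a\<^sup>2 / 8)" using assms by (intro mult_mono) auto
  finally have "b * (1 + h - a) \<le> a - a\<^sup>2 * (3 / 4)" by simp
  moreover have "e * a \<le> a\<^sup>2 / 2"
    using assms mult_right_mono[of e "a/2" a] by (simp add: power2_eq_square)
  moreover have "b * (1 + h - a) = b * (1 + h) - b * a" by (simp add: algebra_simps)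
  ultimately show ?thesis using a2 by linarith
qed

text \<open>The function \<open>G\<close> below is \<open>1\<^sub>X * 1\<^bsub>-C\<^esub>\<close> for \<open>X = A \<inter> (t + B)\<close> of maximal density. It vanishes on \<open>X\<close> but
  is almost invariant under \<open>T\<close>, so it has small correlation with the averages of \<open>1\<^sub>X\<close> over translates
  of \<open>T\<close>. Were these averages at most about the density of \<open>X\<close>, they would be nearly constant on
  \<open>t + D\<close>, and the correlation would be large.\<close>

lemma density_increment:
  assumes p: "p > 0"
    and per: "periodic_set p A" "periodic_set p B" "periodic_set p D" "periodic_set p C" "periodic_set p T"
    and sym: "\<And>x. x \<in> T \<longleftrightarrow> - x \<in> T"
    and pos: "cnt p B > 0" "cnt p C > 0" "cnt p T > 0"
    and DT: "\<And>x y. x \<in> B \<Longrightarrow> y \<in> T \<Longrightarrow> x - y \<in> D"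
    and DC: "\<And>x y. x \<in> B \<Longrightarrow> y \<in> C \<Longrightarrow> x - y \<in> D"
    and D: "cnt p D \<le> (1 + h) * cnt p B"
    and free: "\<And>x y. x \<in> A \<Longrightarrow> y \<in> C \<Longrightarrow> x + y \<notin> A"
    and h: "0 \<le> h" "h \<le> (tdens p A B)\<^sup>2 / 8" and e: "0 \<le> e" "e \<le> tdens p A B / 2"
    and spec: "\<And>k s. s \<in> T \<Longrightarrow>
      norm (\<Sum>y\<in>C \<inter> {0..<int p}. ch p (k * y)) * norm (ch p (k * s) - 1) \<le> e * cnt p C"
  shows "tdens p A B + (tdens p A B)\<^sup>2 / 8 \<le> tdens p A T"
proof (rule ccontr)
  let ?I = "{0..<int p}"
  let ?C = "C \<inter> ?I"
  define a b where "a = tdens p A B" and "b = tdens p A T"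
  assume "\<not> ?thesis"
  hence b_less: "b < a + a\<^sup>2 / 8" by (simp add: a_def b_def)
  have b0: "0 \<le> b" and a0: "0 \<le> a" using tdens_nonneg[OF p] by (auto simp: a_def b_def)
  with b_less have apos: "0 < a" by (cases "a = 0") auto
  have a1: "a \<le> 1" unfolding a_def by (rule tdens_le_1[OF p per(2)])
  obtain t where t: "a = cnt p (A \<inter> {x. x - t \<in> B}) / cnt p B"
    unfolding a_def using tdens_attained[OF p] .
  define X where "X = A \<inter> {x. x - t \<in> B}"
  have cX: "cnt p X = a * cnt p B" using pos t by (simp add: X_def)
  have perX: "periodic_set p X" unfolding X_def by (intro periodic_Int periodic_shift per)
  define G where "G x = (\<Sum>y\<in>?C. of_bool (x + y \<in> X) :: real)" for x
  define H where "H x = cnt p (X \<inter> {y. y - x \<in> T})" for x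
  have cC: "cnt p C = real (card ?C)" by (simp add: cnt_def)
  have perG: "periodic p G"
    unfolding periodic_def G_def
  proof (intro allI impI sum.cong refl)
    fix x y z assume "[x = y] (mod int p)"
    hence "[x + z = y + z] (mod int p)" by (intro cong_add cong_refl)
    from periodicD[OF perX this] show "of_bool (x + z \<in> X) = (of_bool (y + z \<in> X) :: real)" by simp
  qed
  have perXsum: "(\<Sum>x\<in>?I. of_bool (x + y \<in> X)) = cnt p X" for y
    unfolding cnt_eq_sum by (rule sum_shift_mod[OF p periodic_of_bool[OF perX]])
  have sumG: "(\<Sum>x\<in>?I. G x) = cnt p X * cnt p C"
  proof -
    have "(\<Sum>x\<in>?I. G x) = (\<Sum>y\<in>?C. \<Sum>x\<in>?I. of_bool (x + y \<in> X))"
      unfolding G_def by (rule sum.swap)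
    thus ?thesis unfolding perXsum by (simp add: cC)
  qed
  have sumH: "(\<Sum>x\<in>?I. H x) = cnt p X * cnt p T"
    unfolding H_def by (rule sum_cnt_shift[OF p per(5)])
  have H_le: "H x \<le> b * cnt p T" for x
  proof -
    have "H x \<le> cnt p (A \<inter> {y. y - x \<in> T})" unfolding H_def by (rule cnt_mono) (auto simp: X_def)
    also have "\<dots> \<le> b * cnt p T"
      using tdens_ge[OF p per(5), of A x] pos by (simp add: b_def divide_le_eq)
    finally show ?thesis .
  qed
  have G_le: "G x \<le> cnt p C" for x
  proof -
    have "G x \<le> (\<Sum>y\<in>?C. 1)" unfolding G_def by (intro sum_mono) auto
    thus ?thesis by (simp add: cC)
  qed
  have G0: "0 \<le> G x" for x unfolding G_def by (intro sum_nonneg) auto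
  let ?W = "{x. x - t \<in> D}"
  \<comment> \<open>On \<open>t + D\<close> this expands the product of the nonnegative deficits
    \<open>cnt p C - G x\<close> and \<open>b * cnt p T - H x\<close>. Off \<open>t + D\<close> both
    \<open>G\<close> and \<open>H\<close> vanish.\<close>
  have pw: "b * cnt p T * G x - cnt p C * (b * cnt p T * of_bool (x \<in> ?W) - H x) \<le> G x * H x" for x
  proof (cases "x - t \<in> D")
    case True
    have "0 \<le> (cnt p C - G x) * (b * cnt p T - H x)"
      using G_le[of x] H_le[of x] by (intro mult_nonneg_nonneg) auto
    with True show ?thesis by (simp add: algebra_simps)
  next
    case False
    have "G x = 0" unfolding G_def
    proof (rule sum.neutral, intro ballI)
      fix y assume "y \<in> ?C"
      have "x + y \<notin> X"
      proof
        assume "x + y \<in> X"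
        with \<open>y \<in> ?C\<close> have "x + y - t - y \<in> D" by (intro DC) (auto simp: X_def)
        with False show False by simp
      qed
      thus "of_bool (x + y \<in> X) = (0::real)" by simp
    qed
    moreover have "X \<inter> {y. y - x \<in> T} = {}"
    proof (rule ccontr)
      assume "X \<inter> {y. y - x \<in> T} \<noteq> {}"
      then obtain y where "y - t \<in> B" "y - x \<in> T" by (auto simp: X_def)
      from DT[OF this] False show False by simp
    qed
    hence "H x = 0" by (simp add: H_def cnt_def)
    ultimately show ?thesis using False by simp
  qed
  have lower: "b * cnt p T * (cnt p X * cnt p C) - cnt p C * (b * cnt p T * cnt p D - cnt p X * cnt p T)
      \<le> (\<Sum>x\<in>?I. G x * H x)"
  proof -
    have "(\<Sum>x\<in>?I. of_bool (x \<in> ?W)) = cnt p D"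
      unfolding cnt_eq_sum[symmetric] by (rule cnt_shift[OF p per(3)])
    hence "b * cnt p T * (cnt p X * cnt p C) - cnt p C * (b * cnt p T * cnt p D - cnt p X * cnt p T)
      = b * cnt p T * (\<Sum>x\<in>?I. G x) - cnt p C * (b * cnt p T * (\<Sum>x\<in>?I. of_bool (x \<in> ?W)) - (\<Sum>x\<in>?I. H x))"
      by (simp only: sumG sumH)
    also have "\<dots> = (\<Sum>x\<in>?I. b * cnt p T * G x - cnt p C * (b * cnt p T * of_bool (x \<in> ?W) - H x))"
      by (simp only: sum_subtractf sum_distrib_left[symmetric])
    also have "\<dots> \<le> (\<Sum>x\<in>?I. G x * H x)" by (intro sum_mono pw)
    finally show ?thesis .
  qed
  \<comment> \<open>Symmetry of \<open>T\<close> writes \<open>H x\<close> as a sum of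
    \<open>of_bool (x - s \<in> X)\<close> over \<open>s\<close> in \<open>T\<close>; then
    \<open>x\<close> is replaced by \<open>x + s\<close>.\<close>
  have swap: "(\<Sum>x\<in>?I. G x * H x) = (\<Sum>s\<in>T \<inter> ?I. \<Sum>x\<in>?I. of_bool (x \<in> X) * G (x + s))"
  proof -
    have Hx: "H x = (\<Sum>s\<in>?I. of_bool (s \<in> T) * of_bool (x - s \<in> X))" for x
    proof -
      have "(\<Sum>s\<in>?I. of_bool (s \<in> T) * of_bool (x - s \<in> X))
          = (\<Sum>s\<in>?I. (\<lambda>s. of_bool (x - s \<in> T) * of_bool (s \<in> X)) (x - s) :: real)" by simp
      also have "\<dots> = (\<Sum>s\<in>?I. of_bool (x - s \<in> T) * of_bool (s \<in> X))"
      proof (rule sum_reflect_mod[OF p], unfold periodic_def, intro allI impI)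
        fix u v assume uv: "[u = v] (mod int p)"
        hence "[x - u = x - v] (mod int p)" by (intro cong_diff cong_refl)
        from periodicD[OF per(5) this] periodicD[OF perX uv]
        show "of_bool (x - u \<in> T) * of_bool (u \<in> X) = (of_bool (x - v \<in> T) * of_bool (v \<in> X) :: real)"
          by simp
      qed
      also have "\<dots> = H x"
        unfolding H_def cnt_eq_sum
        by (intro sum.cong refl) (use sym[of "x - _"] in \<open>simp add: of_bool_conj mult.commute\<close>)
      finally show ?thesis by simp
    qed
    have "(\<Sum>x\<in>?I. G x * H x) = (\<Sum>s\<in>?I. \<Sum>x\<in>?I. of_bool (s \<in> T) * (G x * of_bool (x - s \<in> X)))"
      unfolding Hx sum_distrib_left by (subst sum.swap) (simp only: mult.left_commute)
    also have "\<dots> = (\<Sum>s\<in>?I. of_bool (s \<in> T) * (\<Sum>x\<in>?I. of_bool (x \<in> X) * G (x + s)))"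
    proof (intro sum.cong refl)
      fix s
      have "(\<Sum>x\<in>?I. G x * of_bool (x - s \<in> X))
          = (\<Sum>x\<in>?I. (\<lambda>x. G x * of_bool (x - s \<in> X)) (x + s))"
        by (rule sum_shift_mod[OF p, symmetric])
           (use perG periodic_shift[OF perX, of s] in \<open>simp add: periodic_def; metis\<close>)
      also have "\<dots> = (\<Sum>x\<in>?I. of_bool (x \<in> X) * G (x + s))"
        by (simp add: mult.commute)
      finally show "(\<Sum>x\<in>?I. of_bool (s \<in> T) * (G x * of_bool (x - s \<in> X)))
          = of_bool (s \<in> T) * (\<Sum>x\<in>?I. of_bool (x \<in> X) * G (x + s))"
        by (simp only: sum_distrib_left[symmetric])
    qed
    also have "\<dots> = (\<Sum>s\<in>?I \<inter> T. \<Sum>x\<in>?I. of_bool (x \<in> X) * G (x + s))"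
      unfolding sum.inter_restrict[OF finite_atLeastLessThan_int] by (intro sum.cong) auto
    finally show ?thesis by (simp add: Int_commute)
  qed
  have zero: "of_bool (x \<in> X) * G x = 0" for x
  proof (cases "x \<in> X")
    case True
    hence "G x = 0" unfolding G_def by (intro sum.neutral) (use free in \<open>auto simp: X_def\<close>)
    thus ?thesis by simp
  qed simp
  \<comment> \<open>Since \<open>G\<close> vanishes on \<open>X\<close>, only the difference
    \<open>G (x + s) - G x\<close> contributes, and almost periodicity controls it.\<close>
  have upper: "(\<Sum>x\<in>?I. of_bool (x \<in> X) * G (x + s)) \<le> e * cnt p C * cnt p X" if "s \<in> T" for s
  proof -
    have "(\<Sum>x\<in>?I. (G (x + s) - G x)\<^sup>2) \<le> (e * cnt p C)\<^sup>2 * cnt p X"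
      unfolding G_def by (rule almost_periodic[OF p perX]) (use e spec[OF that] in auto)
    from sum_indicator_le[OF p _ this] e
    have "(\<Sum>x\<in>?I. of_bool (x \<in> X) * (G (x + s) - G x)) \<le> e * cnt p C * cnt p X" by simp
    thus ?thesis by (simp only: right_diff_distrib zero diff_zero)
  qed
  have "b * cnt p T * (cnt p X * cnt p C) - cnt p C * (b * cnt p T * cnt p D - cnt p X * cnt p T)
     \<le> (\<Sum>s\<in>T \<inter> ?I. e * cnt p C * cnt p X)"
    using lower unfolding swap by (rule order_trans) (intro sum_mono upper, simp)
  also have "\<dots> = cnt p T * (e * cnt p C * cnt p X)" by (simp add: cnt_def)
  finally have "(cnt p C * cnt p T) * (b * cnt p X - b * cnt p D + cnt p X) \<le> (cnt p C * cnt p T) * (e * cnt p X)"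
    by (simp add: algebra_simps)
  hence "b * cnt p X - b * cnt p D + cnt p X \<le> e * cnt p X"
    using pos by (subst (asm) mult_le_cancel_left_pos) auto
  moreover have "b * cnt p D \<le> b * ((1 + h) * cnt p B)" using D b0 by (rule mult_left_mono)
  ultimately have "(b * a - b * (1 + h) + a) * cnt p B \<le> (e * a) * cnt p B"
    unfolding cX by (simp add: algebra_simps)
  hence "b * a - b * (1 + h) + a \<le> e * a" using pos by simp
  moreover have "e * a < b * a - b * (1 + h) + a"
    using increment_arith[OF apos a1 h(1), of e b] h e b_less b0 by (simp add: a_def)
  ultimately show False by simp
qed

section \<open>Bohr sets\<close>

definition dint :: "real \<Rightarrow> real" where
  "dint z = \<bar>z - of_int (round z)\<bar>"

lemma dint_le: "dint z \<le> \<bar>z - of_int n\<bar>"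
  unfolding dint_def by (rule round_diff_minimal)

lemma dint_nonneg [simp]: "0 \<le> dint z" by (simp add: dint_def)

lemma dint_le_half: "dint z \<le> 1 / 2"
  using of_int_round_abs_le[of z] by (simp add: dint_def abs_minus_commute)

lemma dint_diff: "dint (y - z) \<le> dint y + dint z"
  using dint_le[of "y - z" "round y - round z"] by (simp add: dint_def)

lemma dint_minus [simp]: "dint (- z) = dint z"
  using dint_le[of "- z" "- round z"] dint_le[of z "- round (- z)"] by (simp add: dint_def)

lemma dint_add_int [simp]: "dint (z + of_int n) = dint z"
  using dint_le[of "z + of_int n" "round z + n"] dint_le[of z "round (z + of_int n) - n"]
  by (simp add: dint_def)

lemma norm_cis_minus_1_le: "norm (cis t - 1) \<le> \<bar>t\<bar>"
proof (rule power2_le_imp_le)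
  have "(norm (cis t - 1))\<^sup>2 = (cos t - 1)\<^sup>2 + (sin t)\<^sup>2" by (simp add: cmod_power2)
  also have "\<dots> = 2 - 2 * cos t" using sin_cos_squared_add[of t] by (simp add: power2_eq_square algebra_simps)
  also have "\<dots> = 4 * (sin (t / 2))\<^sup>2" using cos_double_sin[of "t / 2"] by simp
  also have "\<dots> \<le> 4 * (t / 2)\<^sup>2"
    using abs_sin_x_le_abs_x[of "t / 2"] unfolding abs_le_square_iff by simp
  finally show "(norm (cis t - 1))\<^sup>2 \<le> \<bar>t\<bar>\<^sup>2" by (simp add: power2_eq_square)
qed simp

text \<open>The nearest integer may be removed from \<open>k / p\<close> without changing the
  character; the chord is then at most the arc.\<close>

lemma norm_ch_minus_1_le: "norm (ch p k - 1) \<le> 2 * pi * dint (real_of_int k / real p)"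
proof -
  define z where "z = real_of_int k / real p"
  have "ch p k = cis (2 * pi * (z - of_int (round z))) * cis (2 * pi * of_int (round z))"
    unfolding cis_mult ch_def z_def[symmetric] by (simp add: algebra_simps)
  also have "cis (2 * pi * of_int (round z)) = 1" by simp
  finally have "norm (ch p k - 1) \<le> \<bar>2 * pi * (z - of_int (round z))\<bar>"
    using norm_cis_minus_1_le by simp
  thus ?thesis by (simp add: dint_def abs_mult z_def)
qed

text \<open>Frequencies are integers, and widths are measured as distances to the nearest integer,
  so every width of at least 1/2 gives all integers. The rank is \<open>card \<Phi>\<close>.\<close>

definition bohr :: "nat \<Rightarrow> int set \<Rightarrow> real \<Rightarrow> int set" where
  "bohr p \<Phi> \<rho> = {x. \<forall>g\<in>\<Phi>. dint (real_of_int (g * x) / real p) \<le> \<rho>}"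

lemma periodic_bohr [intro]:
  assumes "p > 0"
  shows "periodic_set p (bohr p \<Phi> \<rho>)"
  unfolding periodic_def
proof (intro allI impI)
  fix x y assume "[x = y] (mod int p)"
  then obtain n where "x - y = int p * n" by (auto simp: cong_iff_dvd_diff)
  hence n: "x = y + int p * n" by simp
  have "real_of_int (g * x) / real p = real_of_int (g * y) / real p + of_int (g * n)" for g
    using assms unfolding n by (simp add: field_simps)
  hence "dint (real_of_int (g * x) / real p) = dint (real_of_int (g * y) / real p)" for g
    by (simp only: dint_add_int)
  thus "(x \<in> bohr p \<Phi> \<rho>) = (y \<in> bohr p \<Phi> \<rho>)" unfolding bohr_def by simp
qed

lemma bohr_diff:
  assumes "x \<in> bohr p \<Phi> \<rho>" "y \<in> bohr p \<Phi> \<sigma>"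
  shows "x - y \<in> bohr p \<Phi> (\<rho> + \<sigma>)"
  unfolding bohr_def
proof safe
  fix g assume "g \<in> \<Phi>"
  with assms have "dint (real_of_int (g * x) / real p) \<le> \<rho>" "dint (real_of_int (g * y) / real p) \<le> \<sigma>"
    by (auto simp: bohr_def)
  with dint_diff[of "real_of_int (g * x) / real p" "real_of_int (g * y) / real p"]
  show "dint (real_of_int (g * (x - y)) / real p) \<le> \<rho> + \<sigma>"
    by (simp add: right_diff_distrib diff_divide_distrib)
qed

lemma bohr_uminus [simp]: "- x \<in> bohr p \<Phi> \<rho> \<longleftrightarrow> x \<in> bohr p \<Phi> \<rho>"
  by (simp add: bohr_def)

lemma zero_in_bohr: "0 \<le> \<rho> \<Longrightarrow> 0 \<in> bohr p \<Phi> \<rho>"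
  by (simp add: bohr_def dint_def)

lemma bohr_mono: "\<Phi> \<subseteq> \<Psi> \<Longrightarrow> \<rho> \<le> \<sigma> \<Longrightarrow> bohr p \<Psi> \<rho> \<subseteq> bohr p \<Phi> \<sigma>"
  unfolding bohr_def by (auto intro: order_trans)

lemma cnt_bohr_pos:
  assumes "p > 0" "0 \<le> \<rho>"
  shows "0 < cnt p (bohr p \<Phi> \<rho>)"
proof -
  have "0 \<in> bohr p \<Phi> \<rho> \<inter> {0..<int p}" using assms by (simp add: zero_in_bohr)
  hence "card (bohr p \<Phi> \<rho> \<inter> {0..<int p}) > 0" by (subst card_gt_0_iff) auto
  thus ?thesis by (simp add: cnt_def)
qed

text \<open>Pigeonhole: two points of the large Bohr set whose fractional parts lie in the same
  cells of width \<open>\<rho>\<close> differ by an element of the small one.\<close>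

lemma cnt_bohr_scale:
  assumes p: "p > 0" and fin: "finite \<Phi>" and rho: "0 < \<rho>"
  shows "cnt p (bohr p \<Phi> (real K * \<rho>)) \<le> real (2 * K + 1) ^ card \<Phi> * cnt p (bohr p \<Phi> \<rho>)"
proof -
  let ?X = "bohr p \<Phi> (real K * \<rho>) \<inter> {0..<int p}"
  define fr where "fr g x = (let z = real_of_int (g * x) / real p in z - of_int (round z))" for g x
  define cell where "cell x = (\<lambda>g\<in>\<Phi>. \<lfloor>fr g x / \<rho>\<rfloor>)" for x
  \<comment> \<open>The quotients lie between \<open>- K\<close> and \<open>K\<close>, and the floor
    \<open>K\<close> occurs at the right end, which makes \<open>2 * K + 1\<close> cells per
    frequency.\<close>
  let ?V = "\<Phi> \<rightarrow>\<^sub>E {- int K..int K}"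
  have cell: "cell x \<in> ?V" if "x \<in> ?X" for x
  proof -
    have "\<lfloor>fr g x / \<rho>\<rfloor> \<in> {- int K..int K}" if "g \<in> \<Phi>" for g
    proof -
      have "\<bar>fr g x\<bar> \<le> real K * \<rho>"
        using \<open>x \<in> ?X\<close> that by (auto simp: bohr_def dint_def fr_def Let_def)
      hence "- real K \<le> fr g x / \<rho>" "fr g x / \<rho> \<le> real K"
        using rho by (simp_all add: pos_le_divide_eq pos_divide_le_eq abs_le_iff)
      hence "- int K \<le> \<lfloor>fr g x / \<rho>\<rfloor>" "\<lfloor>fr g x / \<rho>\<rfloor> \<le> int K"
        by (simp add: le_floor_iff) (use \<open>fr g x / \<rho> \<le> real K\<close> in linarith)
      thus ?thesis by simp
    qed
    thus ?thesis unfolding cell_def by (intro restrict_PiE_iff[THEN iffD2] ballI)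
  qed
  have fiber: "real (card {x\<in>?X. cell x = v}) \<le> cnt p (bohr p \<Phi> \<rho>)" for v
  proof (cases "\<exists>x0. x0 \<in> ?X \<and> cell x0 = v")
    case True
    then obtain x0 where x0: "x0 \<in> ?X" "cell x0 = v" by auto
    have "x - x0 \<in> bohr p \<Phi> \<rho>" if "cell x = v" for x
      unfolding bohr_def
    proof safe
      fix g assume "g \<in> \<Phi>"
      from that x0 have "cell x g = cell x0 g" by simp
      hence "\<lfloor>fr g x / \<rho>\<rfloor> = \<lfloor>fr g x0 / \<rho>\<rfloor>" using \<open>g \<in> \<Phi>\<close> by (simp add: cell_def)
      hence "\<bar>fr g x / \<rho> - fr g x0 / \<rho>\<bar> < 1"
        using floor_correct[of "fr g x / \<rho>"] floor_correct[of "fr g x0 / \<rho>"] by linarith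
      hence "\<bar>fr g x - fr g x0\<bar> < \<rho>"
        using rho by (simp add: diff_divide_distrib[symmetric] abs_divide divide_less_eq)
      moreover have "dint (real_of_int (g * (x - x0)) / real p) \<le> \<bar>fr g x - fr g x0\<bar>"
      proof -
        define a b where "a = real_of_int (g * x) / real p" and "b = real_of_int (g * x0) / real p"
        have "real_of_int (g * (x - x0)) / real p = a - b"
          by (simp add: a_def b_def right_diff_distrib diff_divide_distrib)
        moreover have "fr g x - fr g x0 = a - b - of_int (round a - round b)"
          by (simp add: fr_def Let_def a_def b_def)
        ultimately show ?thesis using dint_le by (simp only:)
      qed
      ultimately show "dint (real_of_int (g * (x - x0)) / real p) \<le> \<rho>" by simp
    qed
    hence "cnt p {x\<in>?X. cell x = v} \<le> cnt p {x. x - x0 \<in> bohr p \<Phi> \<rho>}" by (intro cnt_mono) auto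
    moreover have "{x\<in>?X. cell x = v} \<inter> {0..<int p} = {x\<in>?X. cell x = v}" by auto
    ultimately show ?thesis
      unfolding cnt_shift[OF p periodic_bohr[OF p]] by (simp only: cnt_def[of p "{x\<in>?X. cell x = v}"])
  next
    case False
    hence "{x\<in>?X. cell x = v} = {}" by auto
    thus ?thesis by (simp only: card.empty of_nat_0 cnt_nonneg)
  qed
  have "?X \<subseteq> (\<Union>v\<in>?V. {x\<in>?X. cell x = v})"
  proof
    fix x assume "x \<in> ?X"
    with cell[OF this] show "x \<in> (\<Union>v\<in>?V. {x\<in>?X. cell x = v})"
      by (intro UN_I[of "cell x"] CollectI conjI refl)
  qed
  moreover have "finite (\<Union>v\<in>?V. {x\<in>?X. cell x = v})"
    by (rule finite_subset[of _ "{0..<int p}"]) auto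
  ultimately have "card ?X \<le> card (\<Union>v\<in>?V. {x\<in>?X. cell x = v})" by (intro card_mono)
  also have "\<dots> \<le> (\<Sum>v\<in>?V. card {x\<in>?X. cell x = v})"
    by (rule card_UN_le) (auto intro: finite_PiE fin)
  finally have "real (card ?X) \<le> (\<Sum>v\<in>?V. real (card {x\<in>?X. cell x = v}))"
    by (simp only: of_nat_sum[symmetric] of_nat_le_iff)
  also have "\<dots> \<le> (\<Sum>v\<in>?V. cnt p (bohr p \<Phi> \<rho>))" by (intro sum_mono fiber)
  also have "\<dots> = real (card ?V) * cnt p (bohr p \<Phi> \<rho>)" by simp
  also have "card ?V = (2 * K + 1) ^ card \<Phi>"
  proof -
    have "card {- int K..int K} = 2 * K + 1" unfolding card_atLeastAtMost_int by arith
    thus ?thesis using fin by (simp only: card_PiE prod_constant)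
  qed
  finally show ?thesis by (simp add: cnt_def)
qed

text \<open>The enlarged width is at least 1/2, so the enlarged Bohr set is everything and
  \<open>cnt_bohr_scale\<close> compares it with the small one.\<close>

lemma cnt_bohr_lower:
  assumes "p > 0" "finite \<Phi>" "0 < \<rho>" "1 / 2 \<le> real K * \<rho>"
  shows "real p \<le> real (2 * K + 1) ^ card \<Phi> * cnt p (bohr p \<Phi> \<rho>)"
proof -
  have "dint z \<le> real K * \<rho>" for z using dint_le_half[of z] assms(4) by linarith
  hence "bohr p \<Phi> (real K * \<rho>) = UNIV" by (auto simp: bohr_def)
  hence "cnt p (bohr p \<Phi> (real K * \<rho>)) = real p" by (simp add: cnt_def)
  with cnt_bohr_scale[OF assms(1-3), of K] show ?thesis by simp
qed

section \<open>Regular widths of Bohr sets\<close>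

lemma two_le_power:
  assumes "n > 0"
  shows "2 \<le> (1 + 1 / real n) ^ n"
proof -
  have "- 1 \<le> 1 / real n" by (rule order_trans[of _ 0]) auto
  from Bernoulli_inequality[OF this, of n] assms show ?thesis by simp
qed

text \<open>The interval from \<open>\<rho>\<close> to \<open>2 * \<rho>\<close> is cut into
  \<open>J\<close> steps. Growth by more than \<open>1 + 1/n\<close> at each step would give a total
  factor of at least \<open>2 ^ (3 * D) = 8 ^ D\<close>, whereas doubling the width costs at most
  \<open>5 ^ D\<close>.\<close>

lemma regular_radius:
  assumes p: "p > 0" and fin: "finite \<Phi>" and card: "card \<Phi> \<le> D" and "D > 0" "n > 0" and rho: "0 < \<rho>"
  defines "J \<equiv> 3 * D * n"
  obtains \<rho>' where "\<rho> \<le> \<rho>'" "\<rho>' + \<rho> / real J \<le> 2 * \<rho>"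
    "cnt p (bohr p \<Phi> (\<rho>' + \<rho> / real J)) \<le> (1 + 1 / real n) * cnt p (bohr p \<Phi> \<rho>')"
proof -
  have J: "J > 0" using \<open>D > 0\<close> \<open>n > 0\<close> by (simp add: J_def)
  define N where "N j = cnt p (bohr p \<Phi> (\<rho> + real j * (\<rho> / real J)))" for j
  have N0: "N 0 > 0" using rho by (simp add: N_def cnt_bohr_pos[OF p])
  have "\<exists>j<J. N (Suc j) \<le> (1 + 1 / real n) * N j"
  proof (rule ccontr)
    assume "\<not> ?thesis"
    hence step: "(1 + 1 / real n) * N j < N (Suc j)" if "j < J" for j
      using that by (meson not_le)
    have "(1 + 1 / real n) ^ j * N 0 \<le> N j" if "j \<le> J" for j
      using that
    proof (induction j)
      case (Suc j)
      hence "(1 + 1 / real n) ^ Suc j * N 0 \<le> (1 + 1 / real n) * N j"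
        by (simp add: mult.assoc mult_left_mono)
      also have "\<dots> \<le> N (Suc j)" using step[of j] Suc by simp
      finally show ?case .
    qed simp
    from this[of J] have "(1 + 1 / real n) ^ J * N 0 \<le> cnt p (bohr p \<Phi> (2 * \<rho>))"
      using J by (simp add: N_def)
    also have "\<dots> \<le> 5 ^ card \<Phi> * N 0"
      using cnt_bohr_scale[OF p fin rho, of 2] by (simp add: N_def)
    finally have "(1 + 1 / real n) ^ J \<le> 5 ^ card \<Phi>" using N0 by simp
    also have "\<dots> \<le> 5 ^ D" using card by (intro power_increasing) auto
    also have "\<dots> < (8::real) ^ D" using \<open>D > 0\<close> by (intro power_strict_mono) auto
    also have "\<dots> = 2 ^ (3 * D)" by (simp add: power_mult)
    also have "\<dots> \<le> ((1 + 1 / real n) ^ n) ^ (3 * D)"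
      by (intro power_mono two_le_power \<open>n > 0\<close>) auto
    also have "\<dots> = (1 + 1 / real n) ^ J" by (simp add: J_def power_mult[symmetric] mult_ac)
    finally show False by simp
  qed
  then obtain j where j: "j < J" "N (Suc j) \<le> (1 + 1 / real n) * N j" by auto
  let ?r = "\<rho> + real j * (\<rho> / real J)"
  show ?thesis
  proof (rule that[of ?r])
    show "\<rho> \<le> ?r" using rho by simp
    have "real j + 1 \<le> real J" using j by simp
    hence "(real j + 1) * \<rho> \<le> real J * \<rho>" using rho by (intro mult_right_mono) auto
    thus "?r + \<rho> / real J \<le> 2 * \<rho>" using J by (simp add: field_simps)
    show "cnt p (bohr p \<Phi> (?r + \<rho> / real J)) \<le> (1 + 1 / real n) * cnt p (bohr p \<Phi> ?r)"
      using j(2) by (simp add: N_def algebra_simps add_divide_distrib)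
  qed
qed

section \<open>Large spectrum\<close>

definition fhat :: "nat \<Rightarrow> int set \<Rightarrow> int \<Rightarrow> complex" where
  "fhat p X k = (\<Sum>y\<in>X \<inter> {0..<int p}. ch p (k * y))"

lemma fhat_0 [simp]: "fhat p X 0 = of_real (cnt p X)"
  by (simp add: fhat_def cnt_def)

lemma norm_fhat_le: "norm (fhat p X k) \<le> cnt p X"
  unfolding fhat_def cnt_def
  using sum_norm_le[of "X \<inter> {0..<int p}" "\<lambda>y. ch p (k * y)" "\<lambda>_. 1"] by simp

lemma norm_fhat_minus: "norm (fhat p X (- k)) = norm (fhat p X k)"
proof -
  have "fhat p X (- k) = cnj (fhat p X k)" by (simp add: fhat_def cnj_ch)
  thus ?thesis by simp
qed

lemma fhat_eq_sum: "fhat p X k = (\<Sum>x\<in>{0..<int p}. of_bool (x \<in> X) * ch p (k * x))"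
  unfolding fhat_def Int_commute[of X] sum.inter_restrict[OF finite_atLeastLessThan_int]
  by (intro sum.cong) auto

text \<open>A large sieve inequality by duality. The coefficients over \<open>C\<close> are aligned
  by phases and summed, Cauchy-Schwarz is applied over \<open>C\<close>, and the sum of squares is
  enlarged from \<open>C\<close> to \<open>S\<close>. Expanding it there, almost orthogonality
  bounds the off-diagonal terms.\<close>

lemma large_spectrum_card:
  assumes fin: "finite \<Lambda>" and CS: "C \<subseteq> S" and pos: "cnt p C > 0"
    and kap: "\<kappa> * cnt p S \<le> cnt p C" and tau: "0 \<le> \<tau>" and eps: "0 \<le> \<epsilon>"
    and large: "\<And>k. k \<in> \<Lambda> \<Longrightarrow> \<tau> * cnt p C \<le> norm (fhat p C k)"
    and orth: "\<And>k l. k \<in> \<Lambda> \<Longrightarrow> l \<in> \<Lambda> \<Longrightarrow> k \<noteq> l \<Longrightarrow> norm (fhat p S (k - l)) \<le> \<epsilon> * cnt p S"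
  shows "\<kappa> * \<tau>\<^sup>2 * real (card \<Lambda>) \<le> 1 + \<epsilon> * real (card \<Lambda>)"
proof (cases "card \<Lambda> = 0")
  case False
  define n where "n = real (card \<Lambda>)"
  have n: "n > 0" using False by (simp add: n_def)
  \<comment> \<open>This phase makes \<open>u k * fhat p C k\<close> real and nonnegative. As
    \<open>sgn 0 = 0\<close>, its norm is only bounded by 1.\<close>
  define u where "u k = cnj (sgn (fhat p C k))" for k
  have u1: "norm (u k) \<le> 1" for k by (simp add: u_def norm_sgn)
  define F where "F y = (\<Sum>k\<in>\<Lambda>. u k * ch p (k * y))" for y
  let ?C = "C \<inter> {0..<int p}" and ?S = "S \<inter> {0..<int p}"
  have posS: "cnt p S > 0" using pos cnt_mono[of C S p] CS by (meson less_le_trans subsetD)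
  have uz: "u k * fhat p C k = of_real (norm (fhat p C k))" for k
    by (simp add: u_def sgn_eq complex_norm_square[symmetric] power2_eq_square mult.commute)
  have "n * (\<tau> * cnt p C) = (\<Sum>k\<in>\<Lambda>. \<tau> * cnt p C)" by (simp add: n_def)
  also have "\<dots> \<le> (\<Sum>k\<in>\<Lambda>. norm (fhat p C k))" by (intro sum_mono large)
  also have "\<dots> = norm (\<Sum>k\<in>\<Lambda>. u k * fhat p C k)"
    unfolding uz by (simp add: sum_nonneg flip: of_real_sum)
  also have "(\<Sum>k\<in>\<Lambda>. u k * fhat p C k) = (\<Sum>y\<in>?C. F y)"
    unfolding fhat_def F_def sum_distrib_left by (rule sum.swap)
  also have "norm \<dots> \<le> (\<Sum>y\<in>?C. 1 * norm (F y))" by (simp add: norm_sum)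
  finally have "(n * (\<tau> * cnt p C))\<^sup>2 \<le> (\<Sum>y\<in>?C. 1 * norm (F y))\<^sup>2"
    using n tau by (intro power_mono) auto
  also have "\<dots> \<le> (\<Sum>y\<in>?C. 1\<^sup>2) * (\<Sum>y\<in>?C. (norm (F y))\<^sup>2)"
    by (rule Cauchy_Schwarz_ineq_sum)
  also have "\<dots> \<le> cnt p C * (\<Sum>y\<in>?S. (norm (F y))\<^sup>2)"
    using CS by (auto simp: cnt_def intro!: mult_left_mono sum_mono2)
  also have "(\<Sum>y\<in>?S. (norm (F y))\<^sup>2) \<le> (n + n * n * \<epsilon>) * cnt p S"
  proof -
    have key: "ch p ((k - l) * y) = ch p (k * y) * ch p (- (l * y))" for k l y
      by (simp add: ch_add[symmetric] algebra_simps)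
    have "complex_of_real (\<Sum>y\<in>?S. (norm (F y))\<^sup>2) = (\<Sum>y\<in>?S. F y * cnj (F y))"
      by (simp add: complex_norm_square del: of_real_power)
    also have "\<dots> = (\<Sum>y\<in>?S. \<Sum>k\<in>\<Lambda>. \<Sum>l\<in>\<Lambda>. u k * cnj (u l) * ch p ((k - l) * y))"
      unfolding F_def cnj_sum sum_product key by (simp add: cnj_ch mult_ac)
    also have "\<dots> = (\<Sum>k\<in>\<Lambda>. \<Sum>y\<in>?S. \<Sum>l\<in>\<Lambda>. u k * cnj (u l) * ch p ((k - l) * y))"
      by (rule sum.swap)
    also have "\<dots> = (\<Sum>k\<in>\<Lambda>. \<Sum>l\<in>\<Lambda>. u k * cnj (u l) * fhat p S (k - l))"
      unfolding fhat_def sum_distrib_left by (rule sum.cong[OF refl], rule sum.swap)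
    finally have "norm (complex_of_real (\<Sum>y\<in>?S. (norm (F y))\<^sup>2))
        = norm (\<Sum>k\<in>\<Lambda>. \<Sum>l\<in>\<Lambda>. u k * cnj (u l) * fhat p S (k - l))" by (simp only:)
    hence "(\<Sum>y\<in>?S. (norm (F y))\<^sup>2) = norm (\<Sum>k\<in>\<Lambda>. \<Sum>l\<in>\<Lambda>. u k * cnj (u l) * fhat p S (k - l))"
      by (simp only: norm_of_real abs_of_nonneg sum_nonneg zero_le_power2)
    also have "\<dots> \<le> (\<Sum>k\<in>\<Lambda>. \<Sum>l\<in>\<Lambda>. norm (u k * cnj (u l) * fhat p S (k - l)))"
      by (intro sum_norm_le) simp
    \<comment> \<open>The error term is added on the diagonal as well, which only weakens the bound
      and gives the double sum a closed form.\<close>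
    also have "\<dots> \<le> (\<Sum>k\<in>\<Lambda>. \<Sum>l\<in>\<Lambda>. (if k = l then cnt p S else 0) + \<epsilon> * cnt p S)"
    proof (intro sum_mono)
      fix k l assume kl: "k \<in> \<Lambda>" "l \<in> \<Lambda>"
      have "norm (u k * cnj (u l)) \<le> 1 * 1"
        unfolding norm_mult by (intro mult_mono) (use u1 in auto)
      hence "norm (u k * cnj (u l)) * norm (fhat p S (k - l)) \<le> 1 * norm (fhat p S (k - l))"
        by (intro mult_right_mono) auto
      also have "\<dots> \<le> (if k = l then cnt p S else 0) + \<epsilon> * cnt p S"
        using orth[OF kl] eps by auto
      finally show "norm (u k * cnj (u l) * fhat p S (k - l)) \<le> (if k = l then cnt p S else 0) + \<epsilon> * cnt p S"
        by (simp only: norm_mult)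
    qed
    also have "\<dots> = (n + n * n * \<epsilon>) * cnt p S"
      using fin by (simp add: sum.distrib n_def algebra_simps)
    finally show ?thesis .
  qed
  finally have "(n * (\<tau> * cnt p C))\<^sup>2 \<le> cnt p C * ((n + n * n * \<epsilon>) * cnt p S)"
    by (simp add: mult_left_mono)
  hence "cnt p C * (n * (n * \<tau>\<^sup>2 * cnt p C)) \<le> cnt p C * (n * ((1 + \<epsilon> * n) * cnt p S))"
    by (simp add: power2_eq_square algebra_simps)
  hence "n * \<tau>\<^sup>2 * cnt p C \<le> (1 + \<epsilon> * n) * cnt p S" using pos n by simp
  moreover have "n * \<tau>\<^sup>2 * (\<kappa> * cnt p S) \<le> n * \<tau>\<^sup>2 * cnt p C"
    using n by (intro mult_left_mono kap) auto
  ultimately have "(\<kappa> * \<tau>\<^sup>2 * n) * cnt p S \<le> (1 + \<epsilon> * n) * cnt p S" by (simp add: mult_ac)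
  thus ?thesis using posS by (simp add: n_def)
qed simp

text \<open>Translating \<open>S\<close> by \<open>s\<close> multiplies its transform by
  \<open>ch p (k * s)\<close>. Yet \<open>S\<close> and its translate both lie in \<open>D\<close>,
  which is barely larger, so they differ in few points.\<close>

lemma fhat_regular:
  assumes p: "p > 0" and per: "periodic_set p S" "periodic_set p D"
    and sub: "S \<subseteq> D" "\<And>x. x \<in> S \<Longrightarrow> x + s \<in> D" and D: "cnt p D \<le> (1 + h) * cnt p S"
  shows "norm (fhat p S k) * norm (ch p (k * s) - 1) \<le> 2 * h * cnt p S"
proof -
  let ?I = "{0..<int p}"
  have "fhat p S k * ch p (k * s) = (\<Sum>x\<in>?I. (\<lambda>x. of_bool (x - s \<in> S) * ch p (k * x)) (x + s))"
    unfolding fhat_eq_sum sum_distrib_right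
    by (intro sum.cong refl) (simp add: distrib_left ch_add)
  also have "\<dots> = (\<Sum>x\<in>?I. of_bool (x - s \<in> S) * ch p (k * x))"
  proof (rule sum_shift_mod[OF p], unfold periodic_def, intro allI impI)
    fix x y assume xy: "[x = y] (mod int p)"
    from periodicD[OF periodic_shift[OF per(1)] xy, of s] periodicD[OF periodic_ch_mult[OF p] xy, of k]
    show "of_bool (x - s \<in> S) * ch p (k * x) = of_bool (y - s \<in> S) * ch p (k * y)" by simp
  qed
  finally have "fhat p S k * (ch p (k * s) - 1)
      = (\<Sum>x\<in>?I. (of_bool (x - s \<in> S) - of_bool (x \<in> S)) * ch p (k * x))"
    by (simp only: right_diff_distrib mult_1_right left_diff_distrib sum_subtractf fhat_eq_sum[of p S k])
  hence "norm (fhat p S k) * norm (ch p (k * s) - 1)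
      = norm (\<Sum>x\<in>?I. (of_bool (x - s \<in> S) - of_bool (x \<in> S)) * ch p (k * x))"
    by (simp only: norm_mult[symmetric])
  also have "\<dots> \<le> (\<Sum>x\<in>?I. 2 * of_bool (x \<in> D) - of_bool (x \<in> {x. x - s \<in> S}) - of_bool (x \<in> S))"
  proof (rule sum_norm_le)
    fix x
    show "norm ((of_bool (x - s \<in> S) - of_bool (x \<in> S)) * ch p (k * x))
      \<le> 2 * of_bool (x \<in> D) - of_bool (x \<in> {x. x - s \<in> S}) - of_bool (x \<in> S)"
      using sub(1) sub(2)[of "x - s"] by (auto simp: norm_mult)
  qed
  also have "\<dots> = 2 * cnt p D - cnt p {x. x - s \<in> S} - cnt p S"
    unfolding cnt_eq_sum by (simp only: sum_subtractf sum_distrib_left[symmetric])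
  also have "\<dots> \<le> 2 * h * cnt p S"
    using D unfolding cnt_shift[OF p per(1)] by (simp add: algebra_simps)
  finally show ?thesis .
qed

text \<open>\<open>\<Lambda>\<close> is a largest almost orthogonal (over \<open>S\<close>) subset of the large spectrum.\<close>

lemma spectrum_representatives:
  assumes CS: "C \<subseteq> S" and pos: "cnt p C > 0" and kap: "\<kappa> * cnt p S \<le> cnt p C" and tau: "0 \<le> \<tau>"
    and eps: "0 \<le> \<epsilon>" "\<epsilon> < 1" "2 * \<epsilon> \<le> \<kappa> * \<tau>\<^sup>2" and M: "1 \<le> \<epsilon> * real M"
  obtains \<Lambda> where "finite \<Lambda>" "card \<Lambda> \<le> M"
    "\<And>k. \<tau> * cnt p C \<le> norm (fhat p C k) \<Longrightarrow> \<exists>l\<in>\<Lambda>. \<epsilon> * cnt p S < norm (fhat p S (k - l))"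
proof -
  define V where "V \<Lambda> \<longleftrightarrow> finite \<Lambda> \<and> (\<forall>k\<in>\<Lambda>. \<tau> * cnt p C \<le> norm (fhat p C k)) \<and>
    (\<forall>k\<in>\<Lambda>. \<forall>l\<in>\<Lambda>. k \<noteq> l \<longrightarrow> norm (fhat p S (k - l)) \<le> \<epsilon> * cnt p S)" for \<Lambda>
  \<comment> \<open>With \<open>2 * \<epsilon> \<le> \<kappa> * \<tau>^2\<close>, the large sieve
    bound reduces to \<open>\<epsilon> * card \<Lambda> \<le> 1\<close>.\<close>
  have bound: "card \<Lambda> \<le> M" if "V \<Lambda>" for \<Lambda>
  proof -
    have "\<kappa> * \<tau>\<^sup>2 * real (card \<Lambda>) \<le> 1 + \<epsilon> * real (card \<Lambda>)"
      by (rule large_spectrum_card[OF _ CS pos kap tau eps(1)]) (use that in \<open>auto simp: V_def\<close>)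
    moreover have "2 * \<epsilon> * real (card \<Lambda>) \<le> \<kappa> * \<tau>\<^sup>2 * real (card \<Lambda>)"
      using eps(3) by (rule mult_right_mono) simp
    ultimately have "\<epsilon> * real (card \<Lambda>) \<le> \<epsilon> * real M" using M by simp
    moreover have "\<epsilon> > 0" using M eps(1) by (cases "\<epsilon> = 0") auto
    ultimately show ?thesis by simp
  qed
  have "V {}" by (simp add: V_def)
  then obtain \<Lambda> where \<Lambda>: "V \<Lambda>" and max: "\<And>\<Lambda>'. V \<Lambda>' \<Longrightarrow> card \<Lambda>' \<le> card \<Lambda>"
    using ex_has_greatest_nat[of V "{}" card "Suc M"] bound by (auto simp: less_Suc_eq_le)
  have posS: "cnt p S > 0" using pos cnt_mono[of C S p] CS by (meson less_le_trans subsetD)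
  show ?thesis
  proof (rule that)
    show "finite \<Lambda>" using \<Lambda> by (simp add: V_def)
    show "card \<Lambda> \<le> M" using bound[OF \<Lambda>] .
    fix k assume k: "\<tau> * cnt p C \<le> norm (fhat p C k)"
    show "\<exists>l\<in>\<Lambda>. \<epsilon> * cnt p S < norm (fhat p S (k - l))"
    proof (cases "k \<in> \<Lambda>")
      case True
      with eps posS show ?thesis by (intro bexI[of _ k]) auto
    next
      case False
      show ?thesis
      proof (rule ccontr)
        assume "\<not> ?thesis"
        hence *: "norm (fhat p S (k - l)) \<le> \<epsilon> * cnt p S" if "l \<in> \<Lambda>" for l
          using that by (meson not_le)
        moreover have "norm (fhat p S (l - k)) \<le> \<epsilon> * cnt p S" if "l \<in> \<Lambda>" for l
          using *[OF that] norm_fhat_minus[of p S "k - l"] by simp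
        \<comment> \<open>Otherwise \<open>k\<close> could be adjoined, against maximality;
          conjugation symmetry covers the differences in the other order.\<close>
        ultimately have "V (insert k \<Lambda>)" using \<Lambda> k by (auto simp: V_def)
        from max[OF this] show False using False \<Lambda> by (simp add: V_def)
      qed
    qed
  qed
qed

text \<open>Outside the large spectrum the trivial bound 2 for the second factor suffices. A large
  frequency \<open>k\<close> is close to some \<open>l\<close> in \<open>\<Lambda>\<close>:
  regularity of the Bohr set makes \<open>ch p ((k - l) * s)\<close> nearly 1, and the new frequency
  \<open>l\<close> makes \<open>ch p (l * s)\<close> nearly 1. Thus at most \<open>M\<close> further
  frequencies handle the whole spectrum.\<close>

lemma spectrum_annihilator:
  assumes p: "p > 0" and fin: "finite \<Phi>" and sig: "0 \<le> \<rho>" "0 \<le> \<sigma>"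
    and reg: "cnt p (bohr p \<Phi> (\<rho> + \<sigma>)) \<le> (1 + h) * cnt p (bohr p \<Phi> \<rho>)" and h: "0 \<le> h"
    and CS: "C \<subseteq> bohr p \<Phi> \<rho>" and pos: "cnt p C > 0"
    and kap: "\<kappa> * cnt p (bohr p \<Phi> \<rho>) \<le> cnt p C" and tau: "0 \<le> \<tau>"
    and eps: "0 < \<epsilon>" "\<epsilon> < 1" "2 * \<epsilon> \<le> \<kappa> * \<tau>\<^sup>2" and M: "1 \<le> \<epsilon> * real M"
    and e: "2 * \<tau> \<le> e" "2 * h / \<epsilon> + 2 * pi * \<delta> \<le> e"
  obtains \<Lambda> where "finite \<Lambda>" "card \<Lambda> \<le> M"
    "\<And>k s. s \<in> bohr p \<Phi> \<sigma> \<Longrightarrow> s \<in> bohr p \<Lambda> \<delta> \<Longrightarrow>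
       norm (fhat p C k) * norm (ch p (k * s) - 1) \<le> e * cnt p C"
proof -
  let ?S = "bohr p \<Phi> \<rho>"
  obtain \<Lambda> where \<Lambda>: "finite \<Lambda>" "card \<Lambda> \<le> M"
    and rep: "\<And>k. \<tau> * cnt p C \<le> norm (fhat p C k) \<Longrightarrow> \<exists>l\<in>\<Lambda>. \<epsilon> * cnt p ?S < norm (fhat p ?S (k - l))"
    using spectrum_representatives[OF CS pos kap tau _ eps(2,3) M] eps(1) by (metis less_imp_le)
  show ?thesis
  proof (rule that[OF \<Lambda>])
    fix k s assume s: "s \<in> bohr p \<Phi> \<sigma>" "s \<in> bohr p \<Lambda> \<delta>"
    show "norm (fhat p C k) * norm (ch p (k * s) - 1) \<le> e * cnt p C"
    proof (cases "\<tau> * cnt p C \<le> norm (fhat p C k)")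
      case False
      have "norm (ch p (k * s) - 1) \<le> 2" using norm_triangle_ineq4[of "ch p (k * s)" 1] by simp
      with False have "norm (fhat p C k) * norm (ch p (k * s) - 1) \<le> (\<tau> * cnt p C) * 2"
        using tau by (intro mult_mono) auto
      also have "\<dots> \<le> e * cnt p C" using mult_right_mono[OF e(1), of "cnt p C"] by simp
      finally show ?thesis .
    next
      case True
      from rep[OF this] obtain l where l: "l \<in> \<Lambda>" "\<epsilon> * cnt p ?S < norm (fhat p ?S (k - l))" by blast
      have S: "cnt p ?S > 0" by (rule cnt_bohr_pos[OF p sig(1)])
      have "(\<epsilon> * cnt p ?S) * norm (ch p ((k - l) * s) - 1)
          \<le> norm (fhat p ?S (k - l)) * norm (ch p ((k - l) * s) - 1)"
        using l(2) by (intro mult_right_mono) auto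
      also have "\<dots> \<le> 2 * h * cnt p ?S"
      proof (rule fhat_regular[OF p periodic_bohr[OF p] periodic_bohr[OF p] _ _ reg])
        show "?S \<subseteq> bohr p \<Phi> (\<rho> + \<sigma>)" using sig by (intro bohr_mono) auto
        show "x + s \<in> bohr p \<Phi> (\<rho> + \<sigma>)" if "x \<in> ?S" for x
          using bohr_diff[OF that, of "- s" \<sigma>] s(1) by simp
      qed
      finally have "(\<epsilon> * norm (ch p ((k - l) * s) - 1)) * cnt p ?S \<le> (2 * h) * cnt p ?S"
        by (simp add: mult_ac)
      hence 1: "norm (ch p ((k - l) * s) - 1) \<le> 2 * h / \<epsilon>"
        using S eps by (simp add: pos_le_divide_eq mult.commute)
      have "norm (ch p (l * s) - 1) \<le> 2 * pi * dint (real_of_int (l * s) / real p)"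
        by (rule norm_ch_minus_1_le)
      also have "\<dots> \<le> 2 * pi * \<delta>" using l(1) s(2) by (intro mult_left_mono) (auto simp: bohr_def)
      finally have 2: "norm (ch p (l * s) - 1) \<le> 2 * pi * \<delta>" .
      have "ch p (k * s) - 1 = ch p (l * s) * (ch p ((k - l) * s) - 1) + (ch p (l * s) - 1)"
        by (simp add: right_diff_distrib ch_add[symmetric] left_diff_distrib)
      hence "norm (ch p (k * s) - 1) \<le> norm (ch p (l * s) * (ch p ((k - l) * s) - 1)) + norm (ch p (l * s) - 1)"
        by (simp only: norm_triangle_ineq)
      also have "\<dots> \<le> e" using 1 2 e(2) by (simp add: norm_mult)
      finally have "norm (fhat p C k) * norm (ch p (k * s) - 1) \<le> cnt p C * e"
        by (intro mult_mono norm_fhat_le) auto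
      thus ?thesis by (simp add: mult.commute)
    qed
  qed
qed

section \<open>Potential argument\<close>

locale sum_free_colouring =
  fixes p r :: nat and b c :: int and A :: "nat \<Rightarrow> int set"
  assumes p_pos: "p > 0" and r_pos: "r > 0" and inverse: "[b * c = 1] (mod int p)"
    and periodic_class: "periodic_set p (A i)"
    and cover: "\<not> int p dvd x \<Longrightarrow> \<exists>i\<in>{1..r}. x \<in> A i"
    and free: "x \<in> A i \<Longrightarrow> y \<in> A i \<Longrightarrow> x + c * y \<notin> A i"
begin

lemma coprime_c: "coprime c (int p)"
  using inverse by (metis coprime_iff_invertible_int mult.commute)

lemma periodic_dilate: "periodic_set p X \<Longrightarrow> periodic_set p {x. c * x \<in> X}"
  unfolding periodic_def by (auto dest: cong_mult[OF cong_refl[of c]])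

lemma cnt_dilate:
  assumes "periodic_set p X"
  shows "cnt p {x. c * x \<in> X} = cnt p X"
  unfolding cnt_eq_sum mem_Collect_eq
  by (rule sum_mult_mod[OF p_pos periodic_of_bool[OF assms] coprime_c])

text \<open>Every nonzero residue of \<open>S\<close> is taken by \<open>b\<close> into some class,
  and the residue 0 is at most half of \<open>S\<close>. The set found is the intersection of
  \<open>S\<close> with the dilate of \<open>A i\<close> by \<open>c\<close>.\<close>

lemma popular_class:
  assumes S: "periodic_set p S" and two: "cnt p S \<ge> 2"
  obtains i where "i \<in> {1..r}" "1 / (2 * real r) * cnt p S \<le> cnt p {y \<in> S. b * y \<in> A i}"
proof -
  let ?C = "\<lambda>i. {y \<in> S. b * y \<in> A i}"
  have "cnt p S \<le> (\<Sum>x\<in>{0..<int p}. of_bool (x = 0) + (\<Sum>i\<in>{1..r}. of_bool (x \<in> ?C i)))"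
    unfolding cnt_eq_sum
  proof (rule sum_mono)
    fix x assume x: "x \<in> {0..<int p}"
    show "of_bool (x \<in> S) \<le> (of_bool (x = 0) + (\<Sum>i\<in>{1..r}. of_bool (x \<in> ?C i)) :: real)"
    proof (cases "x \<in> S \<and> x \<noteq> 0")
      case True
      have "\<not> int p dvd b * x"
      proof
        assume "int p dvd b * x"
        hence "int p dvd c * (b * x)" by simp
        moreover have "[c * (b * x) = x] (mod int p)"
          using cong_mult[OF inverse cong_refl[of x]] by (simp add: mult_ac)
        ultimately have "int p dvd x" by (simp add: cong_dvd_iff)
        with x True show False by (auto dest: zdvd_imp_le)
      qed
      from cover[OF this] obtain i where i: "i \<in> {1..r}" "b * x \<in> A i" by auto
      have "(1::real) = of_bool (x \<in> ?C i)" using i True by simp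
      also have "\<dots> \<le> (\<Sum>i\<in>{1..r}. of_bool (x \<in> ?C i))"
        using i(1) by (intro member_le_sum) auto
      finally show ?thesis using True by simp
    next
      case False
      have "0 \<le> (\<Sum>i\<in>{1..r}. of_bool (x \<in> ?C i) :: real)" by (rule sum_nonneg) simp
      with False show ?thesis by auto
    qed
  qed
  also have "\<dots> = 1 + (\<Sum>i\<in>{1..r}. cnt p (?C i))"
  proof -
    have "(\<Sum>x\<in>{0..<int p}. of_bool (x = 0)) = (1::real)"
      using p_pos by (simp add: of_bool_def sum.delta)
    moreover have "(\<Sum>x\<in>{0..<int p}. \<Sum>i\<in>{1..r}. of_bool (x \<in> ?C i)) = (\<Sum>i\<in>{1..r}. cnt p (?C i))"
      unfolding cnt_eq_sum by (rule sum.swap)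
    ultimately show ?thesis by (simp only: sum.distrib)
  qed
  finally have le: "cnt p S / 2 \<le> (\<Sum>i\<in>{1..r}. cnt p (?C i))" using two by simp
  have "\<exists>i\<in>{1..r}. 1 / (2 * real r) * cnt p S \<le> cnt p (?C i)"
  proof (rule ccontr)
    assume "\<not> ?thesis"
    hence "(\<Sum>i\<in>{1..r}. cnt p (?C i)) < (\<Sum>i\<in>{1..r}. 1 / (2 * real r) * cnt p S)"
      using r_pos by (intro sum_strict_mono) (auto simp: not_le)
    also have "\<dots> = cnt p S / 2" using r_pos by simp
    finally show False using le by simp
  qed
  thus ?thesis using that by blast
qed

text \<open>The relative growth tolerated at a regular width. It is the reciprocal of an integer, as
  \<open>regular_radius\<close> provides, and small enough for the losses of all \<open>r\<close>
  classes together to stay below \<open>gain\<close>.\<close>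

definition \<eta> :: real where "\<eta> = 1 / real (32768 * r ^ 4)"
text \<open>Half of \<open>1 / (128 * r^2)\<close>, the increase obtained for one class; the other
  half pays for the losses of all classes.\<close>

definition gain :: real where "gain = 1 / real (256 * r ^ 2)"

text \<open>The threshold between sparse and dense classes is the density
  \<open>1 / (4 * r)\<close>. The last two bounds serve the sparse and the dense case, the second
  one the total loss.\<close>

lemma parameter_bounds:
  shows "0 < \<eta>" "real r * \<eta> \<le> 1 / (256 * real r ^ 2)"
    "1 / (128 * real r ^ 2) \<le> 1 / (4 * real r) - \<eta>"
    "\<eta> \<le> (1 / (4 * real r))\<^sup>2 / 8"
proof -
  have r: "real r \<ge> 1" using r_pos by simp
  have pow: "real r \<le> real r ^ 2" "real r ^ 2 \<le> real r ^ 3" "real r ^ 2 \<le> real r ^ 4"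
    using power_increasing[OF _ r, of 1 2] power_increasing[OF _ r, of 2 3]
      power_increasing[OF _ r, of 2 4] by auto
  have le: "256 * real r ^ 2 \<le> 32768 * real r ^ 3" "128 * real r ^ 2 \<le> 32768 * real r ^ 4"
      "4 * real r \<le> 64 * real r ^ 2"
    using pow zero_le_power2[of "real r"] r by linarith+
  show "0 < \<eta>" using r_pos by (simp add: \<eta>_def)
  have "real r * \<eta> = 1 / (32768 * real r ^ 3)"
    using r_pos by (simp add: \<eta>_def field_simps power4_eq_xxxx power3_eq_cube)
  also have "\<dots> \<le> 1 / (256 * real r ^ 2)"
    using le r by (intro divide_left_mono) auto
  finally show "real r * \<eta> \<le> 1 / (256 * real r ^ 2)" .
  have "\<eta> = 1 / (32768 * real r ^ 4)" by (simp add: \<eta>_def)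
  also have "\<dots> \<le> 1 / (128 * real r ^ 2)"
    using le r by (intro divide_left_mono) auto
  finally have e: "\<eta> \<le> 1 / (128 * real r ^ 2)" .
  thus "\<eta> \<le> (1 / (4 * real r))\<^sup>2 / 8" by (simp add: power2_eq_square)
  have "1 / (64 * real r ^ 2) \<le> 1 / (4 * real r)"
    using le r by (intro divide_left_mono) auto
  moreover have "1 / (64 * real r ^ 2) = 1 / (128 * real r ^ 2) + 1 / (128 * real r ^ 2)"
    by (simp add: field_simps)
  ultimately show "1 / (128 * real r ^ 2) \<le> 1 / (4 * real r) - \<eta>" using e by linarith
qed

definition potential :: "int set \<Rightarrow> real" where
  "potential B = (\<Sum>i\<in>{1..r}. tdens p (A i) B)"

lemma potential_le: "periodic_set p B \<Longrightarrow> potential B \<le> real r"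
  unfolding potential_def using sum_mono[of "{1..r}" "\<lambda>i. tdens p (A i) B" "\<lambda>_. 1"]
  by (simp add: tdens_le_1[OF p_pos])

text \<open>Additive form of \<open>tdens_mono\<close>, since densities are at most 1.\<close>

lemma tdens_descend:
  assumes per: "periodic_set p B" "periodic_set p B'" "periodic_set p D"
    and sum: "\<And>x y. x \<in> B \<Longrightarrow> y \<in> B' \<Longrightarrow> x - y \<in> D"
    and D: "cnt p D \<le> (1 + \<eta>) * cnt p B" and pos: "cnt p B > 0" "cnt p B' > 0"
  shows "tdens p X B - \<eta> \<le> tdens p X B'"
proof -
  have "tdens p X B \<le> (1 + \<eta>) * tdens p X B'"
    by (rule tdens_mono[OF p_pos per(2,3) sum D pos])
  moreover have "\<eta> * tdens p X B' \<le> \<eta> * 1"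
    using parameter_bounds(1) tdens_le_1[OF p_pos per(2)] by (intro mult_left_mono) auto
  ultimately show ?thesis by (simp add: algebra_simps)
qed

text \<open>\<open>\<Lambda>\<close> is fixed before \<open>\<Phi>'\<close>, which leaves the choice
  of the new frequency set to the iteration. The margin shrinks by \<open>(2 * J)^2\<close> because
  a regular width is sought twice, for the set \<open>S\<close> that supplies \<open>C\<close> and
  for the new Bohr set, each time after halving.\<close>

lemma potential_step:
  fixes D :: nat
  defines "J \<equiv> 3 * D * (32768 * r ^ 4)"
  assumes fin: "finite \<Phi>" and card: "card \<Phi> \<le> D" and "D > 0" and rho: "0 \<le> \<rho>"
    and sig: "0 < \<sigma>" "\<sigma> \<le> 1 / (128 * real r)"
    and reg: "cnt p (bohr p \<Phi> (\<rho> + \<sigma>)) \<le> (1 + \<eta>) * cnt p (bohr p \<Phi> \<rho>)"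
    and two: "2 \<le> cnt p (bohr p \<Phi> (\<sigma> / 2))"
  obtains \<Lambda> where "finite \<Lambda>" "card \<Lambda> \<le> 1024 * r ^ 3"
    "\<And>\<Phi>'. finite \<Phi>' \<Longrightarrow> card \<Phi>' \<le> D \<Longrightarrow> \<Phi> \<subseteq> \<Phi>' \<Longrightarrow> \<Lambda> \<subseteq> \<Phi>' \<Longrightarrow> (*) c ` \<Phi> \<subseteq> \<Phi>' \<Longrightarrow>
      \<exists>\<rho>'\<ge>0. cnt p (bohr p \<Phi>' (\<rho>' + \<sigma> / (2 * real J)\<^sup>2)) \<le> (1 + \<eta>) * cnt p (bohr p \<Phi>' \<rho>') \<and>
        potential (bohr p \<Phi> \<rho>) + gain \<le> potential (bohr p \<Phi>' \<rho>')"
proof -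
  have r1: "real r \<ge> 1" using r_pos by simp
  have n: "32768 * r ^ 4 > 0" using r_pos by simp
  have J: "J > 0" using \<open>D > 0\<close> n by (simp add: J_def)
  \<comment> \<open>The first search starts at \<open>\<sigma> / 2\<close>, so that \<open>S\<close>
    and its own margin \<open>\<sigma>2\<close> stay within the margin \<open>\<sigma>\<close> of
    the outer Bohr set.\<close>
  define \<sigma>2 where "\<sigma>2 = \<sigma> / 2 / real J"
  have sig2: "0 < \<sigma>2" "\<sigma>2 \<le> \<sigma>"
  proof -
    show "0 < \<sigma>2" using sig J by (simp add: \<sigma>2_def)
    have "\<sigma> / 2 / real J \<le> \<sigma> / 2 / 1" using sig J by (intro divide_left_mono) auto
    thus "\<sigma>2 \<le> \<sigma>" using sig by (simp add: \<sigma>2_def)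
  qed
  have "0 < \<sigma> / 2" using sig by simp
  obtain \<rho>2 where r2: "\<sigma> / 2 \<le> \<rho>2" "\<rho>2 + \<sigma>2 \<le> 2 * (\<sigma> / 2)"
    and reg2: "cnt p (bohr p \<Phi> (\<rho>2 + \<sigma>2)) \<le> (1 + \<eta>) * cnt p (bohr p \<Phi> \<rho>2)"
    by (rule regular_radius[OF p_pos fin card \<open>D > 0\<close> n \<open>0 < \<sigma> / 2\<close>, folded J_def \<sigma>2_def \<eta>_def])
  define S where "S = bohr p \<Phi> \<rho>2"
  have perS: "periodic_set p S" unfolding S_def by (rule periodic_bohr[OF p_pos])
  have "cnt p (bohr p \<Phi> (\<sigma> / 2)) \<le> cnt p S"
    unfolding S_def by (rule cnt_mono) (use bohr_mono[OF subset_refl r2(1)] in auto)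
  with two have twoS: "2 \<le> cnt p S" by simp
  from popular_class[OF perS this] obtain i where i: "i \<in> {1..r}"
    "1 / (2 * real r) * cnt p S \<le> cnt p {y \<in> S. b * y \<in> A i}" .
  define C where "C = {y \<in> S. b * y \<in> A i}"
  have perC: "periodic_set p C" unfolding periodic_def
  proof (intro allI impI)
    fix x y assume xy: "[x = y] (mod int p)"
    hence "[b * x = b * y] (mod int p)" by (intro cong_mult cong_refl)
    from periodicD[OF periodic_class this] periodicD[OF perS xy]
    show "(x \<in> C) = (y \<in> C)" by (simp add: C_def)
  qed
  have "0 < 1 / (2 * real r) * cnt p S" using twoS r1 by simp
  hence posC: "cnt p C > 0" using i by (simp add: C_def)
  have CS: "C \<subseteq> S" by (auto simp: C_def)
  have freeC: "x + y \<notin> A i" if "x \<in> A i" "y \<in> C" for x y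
  proof -
    have "x + c * (b * y) \<notin> A i" using that by (intro free) (auto simp: C_def)
    moreover have "[x + c * (b * y) = x + y] (mod int p)"
      using cong_mult[OF inverse cong_refl[of y]] by (intro cong_add cong_refl) (simp add: mult_ac)
    ultimately show ?thesis using periodicD[OF periodic_class] by blast
  qed
  \<comment> \<open>This gives equality in \<open>2 * \<epsilon> \<le> \<kappa> * \<tau>^2\<close>
    for \<open>\<kappa> = 1 / (2 * r)\<close> and \<open>\<tau> = 1 / (16 * r)\<close>; its
    reciprocal is the bound on \<open>card \<Lambda>\<close>.\<close>
  define \<epsilon> where "\<epsilon> = 1 / (1024 * real r ^ 3)"
  have "0 \<le> \<rho>2" using r2 sig by simp
  have eps: "0 < \<epsilon>" "\<epsilon> < 1"
  proof -
    show "0 < \<epsilon>" using r1 by (simp add: \<epsilon>_def)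
    have "1 \<le> real r ^ 3" using r1 by simp
    hence "1 < 1024 * real r ^ 3" by linarith
    thus "\<epsilon> < 1" unfolding \<epsilon>_def by (subst divide_less_eq_1_pos) linarith+
  qed
  have eps2: "2 * \<epsilon> \<le> 1 / (2 * real r) * (1 / (16 * real r))\<^sup>2"
    by (simp add: \<epsilon>_def power2_eq_square power3_eq_cube)
  have eps3: "1 \<le> \<epsilon> * real (1024 * r ^ 3)" using r_pos by (simp add: \<epsilon>_def)
  have e1: "2 * (1 / (16 * real r)) \<le> 1 / (8 * real r)" by simp
  \<comment> \<open>The error \<open>1 / (8 * r)\<close>, half of the threshold density, is split
    evenly: \<open>2 * \<eta> / \<epsilon>\<close> equals \<open>1 / (16 * r)\<close>, and the other
    term is at most that because \<open>pi < 4\<close>.\<close>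
  have e2: "2 * \<eta> / \<epsilon> + 2 * pi * (1 / (128 * real r)) \<le> 1 / (8 * real r)"
  proof -
    have "2 * \<eta> / \<epsilon> = 1 / (16 * real r)"
      using r_pos by (simp add: \<eta>_def \<epsilon>_def field_simps power4_eq_xxxx power3_eq_cube)
    moreover have "2 * pi * (1 / (128 * real r)) \<le> 2 * 4 * (1 / (128 * real r))"
      using pi_less_4 by (intro mult_right_mono) auto
    ultimately show ?thesis by simp
  qed
  obtain \<Lambda> where \<Lambda>: "finite \<Lambda>" "card \<Lambda> \<le> 1024 * r ^ 3"
    and ann: "\<And>k s. s \<in> bohr p \<Phi> \<sigma>2 \<Longrightarrow> s \<in> bohr p \<Lambda> (1 / (128 * real r)) \<Longrightarrow>
       norm (fhat p C k) * norm (ch p (k * s) - 1) \<le> 1 / (8 * real r) * cnt p C"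
    using spectrum_annihilator[OF p_pos fin \<open>0 \<le> \<rho>2\<close> less_imp_le[OF sig2(1)] reg2
        less_imp_le[OF parameter_bounds(1)] CS[unfolded S_def] posC i(2)[folded C_def, unfolded S_def]
        _ eps eps2 eps3 e1 e2]
    by auto
  show ?thesis
  proof (rule that[OF \<Lambda>])
    fix \<Phi>' assume \<Phi>': "finite \<Phi>'" "card \<Phi>' \<le> D" "\<Phi> \<subseteq> \<Phi>'" "\<Lambda> \<subseteq> \<Phi>'" "(*) c ` \<Phi> \<subseteq> \<Phi>'"
    have "0 < \<sigma>2 / 2" using sig2 by simp
    moreover have "\<sigma>2 / 2 / real J = \<sigma> / (2 * real J)\<^sup>2"
      by (simp add: \<sigma>2_def power2_eq_square)
    ultimately obtain \<rho>' where r': "\<sigma>2 / 2 \<le> \<rho>'" "\<rho>' + \<sigma> / (2 * real J)\<^sup>2 \<le> 2 * (\<sigma>2 / 2)"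
      and reg': "cnt p (bohr p \<Phi>' (\<rho>' + \<sigma> / (2 * real J)\<^sup>2)) \<le> (1 + \<eta>) * cnt p (bohr p \<Phi>' \<rho>')"
      using regular_radius[OF p_pos \<Phi>'(1,2) \<open>D > 0\<close> n, of "\<sigma>2 / 2"]
      unfolding J_def[symmetric] \<eta>_def[symmetric] by metis
    have rho': "0 \<le> \<rho>'" "\<rho>' \<le> \<sigma>2"
    proof -
      show "0 \<le> \<rho>'" using r' sig2 by simp
      have "0 \<le> \<sigma> / (2 * real J)\<^sup>2" using sig by simp
      with r' show "\<rho>' \<le> \<sigma>2" by linarith
    qed
    define T where "T = bohr p \<Phi>' \<rho>'"
    define B where "B = bohr p \<Phi> \<rho>"
    define Bp where "Bp = bohr p \<Phi> (\<rho> + \<sigma>)"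
    have per: "periodic_set p T" "periodic_set p B" "periodic_set p Bp"
      unfolding T_def B_def Bp_def by (rule periodic_bohr[OF p_pos])+
    have pos: "cnt p T > 0" "cnt p B > 0"
      unfolding T_def B_def using rho' rho by (simp_all add: cnt_bohr_pos[OF p_pos])
    have T1: "T \<subseteq> bohr p \<Phi> \<sigma>2" unfolding T_def by (rule bohr_mono[OF \<Phi>'(3) rho'(2)])
    have T2: "T \<subseteq> bohr p \<Lambda> (1 / (128 * real r))"
      unfolding T_def using rho' sig2 sig by (intro bohr_mono \<Phi>') auto
    \<comment> \<open>The dilated frequencies in \<open>\<Phi>'\<close> keep \<open>c * x\<close>
      small on \<open>\<Phi>\<close>, so that in the sparse case one can descend from the dilate of
      \<open>S\<close> by the inverse of \<open>c\<close>.\<close>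
    have T3: "c * x \<in> bohr p \<Phi> \<sigma>2" if "x \<in> T" for x
      unfolding bohr_def
    proof safe
      fix g assume "g \<in> \<Phi>"
      hence "c * g \<in> \<Phi>'" using \<Phi>'(5) by auto
      with that have "dint (real_of_int (c * g * x) / real p) \<le> \<rho>'" by (auto simp: T_def bohr_def)
      thus "dint (real_of_int (g * (c * x)) / real p) \<le> \<sigma>2" using rho' by (simp add: mult_ac)
    qed
    have BT: "x - y \<in> Bp" if "x \<in> B" "y \<in> T" for x y
    proof -
      have "y \<in> bohr p \<Phi> \<sigma>" using that T1 bohr_mono[OF subset_refl sig2(2)] by blast
      with that show ?thesis unfolding B_def Bp_def by (intro bohr_diff)
    qed
    have descend: "tdens p X B - \<eta> \<le> tdens p X T" for X
      by (rule tdens_descend[OF per(2,1,3) BT _ pos(2,1)]) (use reg in \<open>auto simp: B_def Bp_def\<close>)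
    have incr: "tdens p (A i) B + 1 / (128 * real r ^ 2) - \<eta> \<le> tdens p (A i) T"
    proof (cases "1 / (4 * real r) \<le> tdens p (A i) B")
      case True
      define a where "a = tdens p (A i) B"
      have a2: "(1 / (4 * real r))\<^sup>2 / 8 \<le> a\<^sup>2 / 8"
        using True r1 by (simp add: a_def power_mono)
      have "a + a\<^sup>2 / 8 \<le> tdens p (A i) T"
        unfolding a_def
      proof (rule density_increment[OF p_pos periodic_class per(2,3) perC per(1) _ pos(2) posC pos(1) BT])
        show "x \<in> T \<longleftrightarrow> - x \<in> T" for x by (simp add: T_def)
        show "cnt p Bp \<le> (1 + \<eta>) * cnt p B" using reg by (simp add: B_def Bp_def)
        show "x + y \<notin> A i" if "x \<in> A i" "y \<in> C" for x y by (rule freeC[OF that])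
        show "0 \<le> \<eta>" using parameter_bounds(1) by simp
        show "\<eta> \<le> (tdens p (A i) B)\<^sup>2 / 8" using parameter_bounds(4) a2 by (simp add: a_def)
        show "0 \<le> 1 / (8 * real r)" by simp
        show "1 / (8 * real r) \<le> tdens p (A i) B / 2" using True by simp
        show "norm (\<Sum>y\<in>C \<inter> {0..<int p}. ch p (k * y)) * norm (ch p (k * s) - 1) \<le> 1 / (8 * real r) * cnt p C"
          if "s \<in> T" for k s
          using ann[of s k] that T1 T2 by (auto simp: fhat_def)
        show "x - y \<in> Bp" if "x \<in> B" "y \<in> C" for x y
        proof -
          have "\<rho>2 \<le> \<sigma>" using r2 sig2 by simp
          hence "y \<in> bohr p \<Phi> \<sigma>" using that CS bohr_mono[OF subset_refl] unfolding S_def by blast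
          with that show ?thesis unfolding B_def Bp_def by (intro bohr_diff)
        qed
      qed
      moreover have "1 / (128 * real r ^ 2) \<le> a\<^sup>2 / 8"
        using a2 by (simp add: power2_eq_square)
      ultimately show ?thesis using parameter_bounds(1) by (simp add: a_def)
    next
      case False
      \<comment> \<open>On \<open>?S'\<close> the class has density at least
        \<open>1 / (2 * r)\<close>, twice the threshold. Descending to \<open>T\<close> loses only
        \<open>\<eta>\<close>.\<close>
      let ?S' = "{x. c * x \<in> S}" and ?D = "{x. c * x \<in> bohr p \<Phi> (\<rho>2 + \<sigma>2)}"
      have perD: "periodic_set p ?D" by (rule periodic_dilate[OF periodic_bohr[OF p_pos]])
      have perS': "periodic_set p ?S'" by (rule periodic_dilate[OF perS])
      have cS': "cnt p ?S' = cnt p S" by (rule cnt_dilate[OF perS])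
      have "x \<in> A i \<longleftrightarrow> b * (c * x) \<in> A i" for x
        using cong_mult[OF inverse cong_refl[of x]]
        by (intro periodicD[OF periodic_class]) (simp add: cong_sym mult_ac)
      hence "A i \<inter> {x. x - 0 \<in> ?S'} = {x. c * x \<in> C}" by (auto simp: C_def)
      hence "cnt p C / cnt p S \<le> tdens p (A i) ?S'"
        using tdens_ge[OF p_pos perS', of "A i" 0] cnt_dilate[OF perC] cS' by simp
      moreover have "1 / (2 * real r) \<le> cnt p C / cnt p S"
        using i(2) twoS unfolding C_def by (subst pos_le_divide_eq) auto
      moreover have "tdens p (A i) ?S' - \<eta> \<le> tdens p (A i) T"
      proof (rule tdens_descend[OF perS' per(1) perD _ _ _ pos(1)])
        show "x - y \<in> ?D" if "x \<in> ?S'" "y \<in> T" for x y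
        proof -
          have "c * x - c * y \<in> bohr p \<Phi> (\<rho>2 + \<sigma>2)"
            using that T3 by (intro bohr_diff) (auto simp: S_def)
          thus ?thesis by (simp add: right_diff_distrib)
        qed
        show "cnt p ?D \<le> (1 + \<eta>) * cnt p ?S'"
          unfolding cS' cnt_dilate[OF periodic_bohr[OF p_pos]] using reg2 by (simp add: S_def)
        show "cnt p ?S' > 0" unfolding cS' using twoS by simp
      qed
      moreover have "1 / (2 * real r) = 1 / (4 * real r) + 1 / (4 * real r)" by (simp add: field_simps)
      ultimately show ?thesis using False parameter_bounds(1,3) by linarith
    qed
    \<comment> \<open>Every class loses at most \<open>\<eta>\<close>, and the popular class
      gains.\<close>
    have "potential B + 1 / (128 * real r ^ 2) - real r * \<eta>
        = (\<Sum>j\<in>{1..r}. tdens p (A j) B + (if j = i then 1 / (128 * real r ^ 2) else 0) - \<eta>)"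
      using i(1) by (simp add: potential_def sum.distrib sum_subtractf)
    also have "\<dots> \<le> potential T"
      unfolding potential_def using incr descend by (intro sum_mono) auto
    finally have "potential B + 1 / (128 * real r ^ 2) - real r * \<eta> \<le> potential T" .
    moreover have "1 / (128 * real r ^ 2) = gain + gain" by (simp add: gain_def field_simps)
    moreover have "real r * \<eta> \<le> gain" using parameter_bounds(2) by (simp add: gain_def)
    ultimately have "potential B + gain \<le> potential T" by linarith
    with reg' rho'(1)
    show "\<exists>\<rho>'\<ge>0. cnt p (bohr p \<Phi>' (\<rho>' + \<sigma> / (2 * real J)\<^sup>2)) \<le> (1 + \<eta>) * cnt p (bohr p \<Phi>' \<rho>') \<and>
        potential (bohr p \<Phi> \<rho>) + gain \<le> potential (bohr p \<Phi>' \<rho>')"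
      unfolding B_def T_def by blast
  qed
qed

end

text \<open>The powers of \<open>c\<close> keep the rank polynomial: each step needs a frequency set that contains
  the old one and its dilate by \<open>c\<close>, and taking their union would double the rank every time.\<close>

definition dilates :: "int \<Rightarrow> nat \<Rightarrow> int set \<Rightarrow> int set" where
  "dilates c k \<Gamma> = (\<lambda>(j, g). c ^ j * g) ` ({..k} \<times> \<Gamma>)"

lemma finite_dilates: "finite \<Gamma> \<Longrightarrow> finite (dilates c k \<Gamma>)"
  by (simp add: dilates_def)

lemma card_dilates:
  assumes "finite \<Gamma>"
  shows "card (dilates c k \<Gamma>) \<le> (k + 1) * card \<Gamma>"
  unfolding dilates_def
  using card_image_le[of "{..k} \<times> \<Gamma>" "\<lambda>(j, g). c ^ j * g"] assms by (simp add: card_cartesian_product)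

lemma dilates_mono: "k \<le> l \<Longrightarrow> \<Gamma> \<subseteq> \<Gamma>' \<Longrightarrow> dilates c k \<Gamma> \<subseteq> dilates c l \<Gamma>'"
  unfolding dilates_def by (intro image_mono Sigma_mono) auto

lemma subset_dilates: "\<Gamma> \<subseteq> dilates c k \<Gamma>"
  unfolding dilates_def by (force intro: image_eqI[of _ _ "(0, _)"])

lemma mult_dilates: "(*) c ` dilates c k \<Gamma> \<subseteq> dilates c (Suc k) \<Gamma>"
proof
  fix x assume "x \<in> (*) c ` dilates c k \<Gamma>"
  then obtain j g where "j \<le> k" "g \<in> \<Gamma>" "x = c ^ Suc j * g" by (auto simp: dilates_def mult.assoc)
  thus "x \<in> dilates c (Suc k) \<Gamma>"
    unfolding dilates_def by (intro image_eqI[of _ _ "(Suc j, g)"]) auto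
qed

section \<open>Iteration and the bound on the modulus\<close>

context sum_free_colouring
begin

text \<open>For larger \<open>p\<close> the step could be made \<open>N + 1\<close> times, although
  \<open>N * gain = r\<close> is already the maximum of the potential. \<open>D\<close> bounds every
  rank that occurs, and \<open>K\<close> is the reciprocal of the margin after \<open>N\<close>
  steps.\<close>

lemma modulus_le_power:
  fixes N D J K :: nat
  defines "N \<equiv> 256 * r ^ 3"
  defines "D \<equiv> (N + 2)\<^sup>2 * (1024 * r ^ 3)"
  defines "J \<equiv> 3 * D * (32768 * r ^ 4)"
  defines "K \<equiv> 128 * r * (2 * J) ^ (2 * N)"
  shows "p \<le> (2 * K + 1) ^ D"
proof (rule ccontr)
  let ?M = "1024 * r ^ 3"
  assume "\<not> ?thesis"
  hence large: "(2 * K + 1) ^ D < p" by simp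
  have M: "?M > 0" using r_pos by simp
  have D: "D > 0" using r_pos by (simp add: D_def)
  have J: "J > 0" using r_pos D by (simp add: J_def)
  \<comment> \<open>The margins start at the largest value that \<open>potential_step\<close> admits
    and shrink by its factor each time.\<close>
  define \<sigma> where "\<sigma> k = 1 / (128 * real r) / ((2 * real J)\<^sup>2) ^ k" for k
  have J1: "1 \<le> (2 * real J)\<^sup>2" using J by (intro one_le_power) simp
  have sig: "0 < \<sigma> k" "\<sigma> k \<le> 1 / (128 * real r)" for k
  proof -
    show "0 < \<sigma> k" using J r_pos by (simp add: \<sigma>_def)
    have "1 \<le> ((2 * real J)\<^sup>2) ^ k" using J1 by (rule one_le_power)
    hence "\<sigma> k \<le> 1 / (128 * real r) / 1"
      unfolding \<sigma>_def using r_pos by (intro divide_left_mono) auto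
    thus "\<sigma> k \<le> 1 / (128 * real r)" by simp
  qed
  have rank: "(k + 1) * (k * ?M) \<le> D" if "k \<le> Suc N" for k
  proof -
    have "(k + 1) * k * ?M \<le> (N + 2) * (N + 2) * ?M"
      using that by (intro mult_le_mono1 mult_le_mono) auto
    thus ?thesis by (simp only: D_def power2_eq_square mult.assoc)
  qed
  \<comment> \<open>Invariant: after \<open>k\<close> steps there are at most \<open>k * ?M\<close>
    generators, with powers of \<open>c\<close> up to \<open>k\<close>, hence rank quadratic in
    \<open>k\<close>.\<close>
  have "\<exists>\<Gamma> \<rho>. finite \<Gamma> \<and> card \<Gamma> \<le> k * ?M \<and> 0 \<le> \<rho> \<and>
      cnt p (bohr p (dilates c k \<Gamma>) (\<rho> + \<sigma> k)) \<le> (1 + \<eta>) * cnt p (bohr p (dilates c k \<Gamma>) \<rho>) \<and>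
      real k * gain \<le> potential (bohr p (dilates c k \<Gamma>) \<rho>)" if "k \<le> Suc N" for k
    using that
  proof (induction k)
    case 0
    have "bohr p (dilates c 0 {}) \<rho> = UNIV" for \<rho> by (simp add: bohr_def dilates_def)
    thus ?case
      using parameter_bounds(1) tdens_nonneg[OF p_pos]
      by (intro exI[of _ "{}"] exI[of _ 0]) (auto simp: potential_def algebra_simps intro!: sum_nonneg)
  next
    case (Suc k)
    then obtain \<Gamma> \<rho> where IH: "finite \<Gamma>" "card \<Gamma> \<le> k * ?M" "0 \<le> \<rho>"
      "cnt p (bohr p (dilates c k \<Gamma>) (\<rho> + \<sigma> k)) \<le> (1 + \<eta>) * cnt p (bohr p (dilates c k \<Gamma>) \<rho>)"
      "real k * gain \<le> potential (bohr p (dilates c k \<Gamma>) \<rho>)" by auto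
    let ?\<Phi> = "dilates c k \<Gamma>"
    have fin: "finite ?\<Phi>" by (rule finite_dilates[OF IH(1)])
    have "card ?\<Phi> \<le> (k + 1) * card \<Gamma>" by (rule card_dilates[OF IH(1)])
    also have "\<dots> \<le> (k + 1) * (k * ?M)" by (rule mult_le_mono2[OF IH(2)])
    also have "\<dots> \<le> D" using Suc.prems by (intro rank) simp
    finally have card: "card ?\<Phi> \<le> D" .
    have two: "2 \<le> cnt p (bohr p ?\<Phi> (\<sigma> k / 2))"
    proof -
      have "((2 * real J)\<^sup>2) ^ k \<le> ((2 * real J)\<^sup>2) ^ N"
        using J1 Suc.prems by (intro power_increasing) auto
      hence "1 \<le> ((2 * real J)\<^sup>2) ^ N / ((2 * real J)\<^sup>2) ^ k" using J by simp
      also have "\<dots> = real K * \<sigma> k"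
        using r_pos by (simp add: K_def \<sigma>_def power_mult)
      finally have "1 / 2 \<le> real K * (\<sigma> k / 2)" by simp
      hence "real p \<le> real (2 * K + 1) ^ card ?\<Phi> * cnt p (bohr p ?\<Phi> (\<sigma> k / 2))"
        using sig(1)[of k] by (intro cnt_bohr_lower[OF p_pos fin]) auto
      also have "\<dots> \<le> real (2 * K + 1) ^ D * cnt p (bohr p ?\<Phi> (\<sigma> k / 2))"
        using card by (intro mult_right_mono power_increasing) auto
      finally have le: "real p \<le> real (2 * K + 1) ^ D * cnt p (bohr p ?\<Phi> (\<sigma> k / 2))" .
      have lt: "real (2 * K + 1) ^ D < real p" using large by (simp only: of_nat_power[symmetric] of_nat_less_iff)
      have "1 < cnt p (bohr p ?\<Phi> (\<sigma> k / 2))"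
      proof (rule ccontr)
        assume "\<not> ?thesis"
        hence "real (2 * K + 1) ^ D * cnt p (bohr p ?\<Phi> (\<sigma> k / 2)) \<le> real (2 * K + 1) ^ D * 1"
          by (intro mult_left_mono) auto
        with le lt show False by linarith
      qed
      \<comment> \<open>The count is an integer, so exceeding 1 means at least 2.\<close>
      thus ?thesis by (simp add: cnt_def)
    qed
    obtain \<Lambda> where \<Lambda>: "finite \<Lambda>" "card \<Lambda> \<le> ?M"
      and step: "\<And>\<Phi>'. finite \<Phi>' \<Longrightarrow> card \<Phi>' \<le> D \<Longrightarrow> ?\<Phi> \<subseteq> \<Phi>' \<Longrightarrow> \<Lambda> \<subseteq> \<Phi>' \<Longrightarrow> (*) c ` ?\<Phi> \<subseteq> \<Phi>' \<Longrightarrow>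
      \<exists>\<rho>'\<ge>0. cnt p (bohr p \<Phi>' (\<rho>' + \<sigma> k / (2 * real J)\<^sup>2)) \<le> (1 + \<eta>) * cnt p (bohr p \<Phi>' \<rho>') \<and>
        potential (bohr p ?\<Phi> \<rho>) + gain \<le> potential (bohr p \<Phi>' \<rho>')"
      by (rule potential_step[OF fin card D IH(3) sig IH(4) two, folded J_def]) blast
    let ?\<Gamma>' = "\<Gamma> \<union> \<Lambda>"
    let ?\<Phi>' = "dilates c (Suc k) ?\<Gamma>'"
    have card': "card ?\<Gamma>' \<le> Suc k * ?M" using card_Un_le[of \<Gamma> \<Lambda>] IH(2) \<Lambda>(2) by simp
    have fin': "finite ?\<Gamma>'" using IH(1) \<Lambda>(1) by simp
    have "card ?\<Phi>' \<le> (Suc k + 1) * card ?\<Gamma>'" by (rule card_dilates[OF fin'])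
    also have "\<dots> \<le> (Suc k + 1) * (Suc k * ?M)" by (rule mult_le_mono2[OF card'])
    also have "\<dots> \<le> D" by (rule rank[OF Suc.prems])
    finally have card\<Phi>': "card ?\<Phi>' \<le> D" .
    have "(*) c ` ?\<Phi> \<subseteq> ?\<Phi>'"
      using mult_dilates[of c k \<Gamma>] dilates_mono[of "Suc k" "Suc k" \<Gamma> ?\<Gamma>' c] by auto
    moreover have "\<Lambda> \<subseteq> ?\<Phi>'" using subset_dilates[of ?\<Gamma>' c "Suc k"] by auto
    moreover have "?\<Phi> \<subseteq> ?\<Phi>'" by (intro dilates_mono) auto
    ultimately obtain \<rho>' where "0 \<le> \<rho>'"
      "cnt p (bohr p ?\<Phi>' (\<rho>' + \<sigma> k / (2 * real J)\<^sup>2)) \<le> (1 + \<eta>) * cnt p (bohr p ?\<Phi>' \<rho>')"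
      "potential (bohr p ?\<Phi> \<rho>) + gain \<le> potential (bohr p ?\<Phi>' \<rho>')"
      using step[OF finite_dilates[OF fin'] card\<Phi>'] by blast
    moreover have "\<sigma> k / (2 * real J)\<^sup>2 = \<sigma> (Suc k)" by (simp add: \<sigma>_def)
    moreover have "real (Suc k) * gain = real k * gain + gain" by (simp add: algebra_simps)
    ultimately show ?case
      using fin' card' IH(5) by (intro exI[of _ ?\<Gamma>'] exI[of _ \<rho>']) simp
  qed
  from this[of "Suc N"] obtain \<Gamma> \<rho> where
    "real (Suc N) * gain \<le> potential (bohr p (dilates c (Suc N) \<Gamma>) \<rho>)" by auto
  also have "\<dots> \<le> real r" by (intro potential_le periodic_bohr p_pos)
  finally have "real (Suc N) * gain \<le> real r" .
  moreover have "real N * gain = real r"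
    using r_pos by (simp add: N_def gain_def field_simps power2_eq_square power3_eq_cube)
  moreover have "0 < gain" using r_pos by (simp add: gain_def)
  ultimately show False by (simp add: algebra_simps)
qed

text \<open>The logarithm of the previous bound is at most \<open>2 ^ 84 * r ^ 25\<close>. The
  exponent 84 is dictated by the numerical constant, which the base \<open>2 * r\<close>
  absorbs.\<close>

lemma modulus_le_exp: "real p \<le> exp ((2 * real r) ^ 84)"
proof -
  define N where "N = 256 * r ^ 3"
  define D where "D = (N + 2)\<^sup>2 * (1024 * r ^ 3)"
  define J where "J = 3 * D * (32768 * r ^ 4)"
  define K where "K = 128 * r * (2 * J) ^ (2 * N)"
  have "D > 0" using r_pos by (simp add: D_def)
  hence J: "J > 0" using r_pos by (simp add: J_def)
  have "p \<le> (2 * K + 1) ^ D"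
    using modulus_le_power unfolding K_def J_def D_def N_def .
  hence "real p \<le> real ((2 * K + 1) ^ D)" by (simp only: of_nat_le_iff)
  also have "\<dots> = real (2 * K + 1) ^ D" by simp
  also have "\<dots> \<le> exp (real (384 * r + 4 * J * N)) ^ D"
  proof (rule power_mono)
    \<comment> \<open>\<open>2 * K + 1\<close> is at most \<open>3 * K\<close>, and each factor of
      that is bounded by its exponential.\<close>
    have "1 \<le> K" using J r_pos by (simp add: K_def Suc_le_eq)
    hence "real (2 * K + 1) \<le> real (3 * K)" by simp
    also have "\<dots> = real (384 * r) * real (2 * J) ^ (2 * N)" by (simp add: K_def)
    also have "\<dots> \<le> exp (real (384 * r)) * exp (real (2 * J)) ^ (2 * N)"
      by (intro mult_mono power_mono) (auto intro: order_trans[OF _ exp_ge_add_one_self])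
    also have "\<dots> = exp (real (384 * r + 4 * J * N))"
      by (simp add: exp_add exp_of_nat_mult[symmetric] mult_ac)
    finally show "real (2 * K + 1) \<le> exp (real (384 * r + 4 * J * N))" .
  qed simp
  also have "\<dots> = exp (real (D * (384 * r + 4 * J * N)))"
    by (simp only: exp_of_nat_mult[symmetric] of_nat_mult)
  also have "\<dots> \<le> exp ((2 * real r) ^ 84)"
  proof -
    have r1: "1 \<le> r" using r_pos by simp
    have "N + 2 \<le> 512 * r ^ 3" using one_le_power[OF r1, of 3] by (simp add: N_def)
    hence "(N + 2)\<^sup>2 \<le> (512 * r ^ 3)\<^sup>2" by (rule power_mono) simp
    hence "D \<le> (512 * r ^ 3)\<^sup>2 * (1024 * r ^ 3)" unfolding D_def by (rule mult_le_mono1)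
    also have "\<dots> = 2 ^ 28 * r ^ 9" by (simp add: power_mult_distrib flip: power_mult power_add)
    finally have D: "D \<le> 2 ^ 28 * r ^ 9" .
    have "J \<le> 4 * (2 ^ 28 * r ^ 9) * (32768 * r ^ 4)"
      unfolding J_def by (intro mult_le_mono1 mult_le_mono D) simp
    also have "\<dots> = 2 ^ 45 * r ^ 13" by (simp flip: power_add)
    finally have J: "J \<le> 2 ^ 45 * r ^ 13" .
    have "4 * J * N \<le> 4 * (2 ^ 45 * r ^ 13) * (256 * r ^ 3)"
      unfolding N_def by (intro mult_le_mono1 mult_le_mono2 J)
    also have "\<dots> = 2 ^ 55 * r ^ 16" by (simp flip: power_add)
    finally have "384 * r + 4 * J * N \<le> 2 ^ 56 * r ^ 16"
      using power_increasing[of 1 16 r] r1 by simp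
    with D have "D * (384 * r + 4 * J * N) \<le> (2 ^ 28 * r ^ 9) * (2 ^ 56 * r ^ 16)"
      by (rule mult_le_mono)
    also have "\<dots> = 2 ^ 84 * r ^ 25" by (simp flip: power_add)
    also have "\<dots> \<le> 2 ^ 84 * r ^ 84" using r1 by (intro mult_le_mono2 power_increasing) auto
    also have "\<dots> = (2 * r) ^ 84" by (simp add: power_mult_distrib)
    finally have "real (D * (384 * r + 4 * J * N)) \<le> real ((2 * r) ^ 84)" by (simp only: of_nat_le_iff)
    thus ?thesis by simp
  qed
  finally show ?thesis .
qed

end

section \<open>Reduction to a three-term equation\<close>

text \<open>The colour classes are lifted to periodic sets of integers, and primality of
  \<open>p\<close> supplies the inverse of \<open>c\<close>.\<close>

lemma sum_free_modulus_le:
  fixes p r :: nat and f :: "int \<Rightarrow> nat" and c :: int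
  assumes p: "prime p" and c: "\<not> int p dvd c" and col: "f \<in> {1..<int p} \<rightarrow> {1..r}"
    and free: "\<And>x y z. x \<in> {1..<int p} \<Longrightarrow> y \<in> {1..<int p} \<Longrightarrow> z \<in> {1..<int p} \<Longrightarrow>
      [z = x + c * y] (mod int p) \<Longrightarrow> f x = f y \<Longrightarrow> f x = f z \<Longrightarrow> False"
  shows "real p \<le> exp ((2 * real r) ^ 84)"
proof -
  have p1: "int p > 1" using prime_gt_1_nat[OF p] by simp
  have "prime (int p)" using p by simp
  hence "coprime (int p) c" using c by (rule prime_imp_coprime)
  hence "coprime c (int p)" by (simp only: coprime_commute)
  then obtain b where b: "[c * b = 1] (mod int p)" using cong_solve_coprime_int by blast
  \<comment> \<open>Multiples of \<open>p\<close> are excluded explicitly, since \<open>f\<close>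
    may take any value at 0.\<close>
  define A where "A i = {x. \<not> int p dvd x \<and> f (x mod int p) = i}" for i
  have range: "x mod int p \<in> {1..<int p}" if "\<not> int p dvd x" for x
  proof -
    have "x mod int p \<noteq> 0" using that by (simp add: dvd_eq_mod_eq_0)
    moreover have "0 \<le> x mod int p" "x mod int p < int p" using p1 by simp_all
    ultimately show ?thesis by simp
  qed
  interpret sum_free_colouring p r b c A
  proof
    show "p > 0" using p1 by simp
    have "1 \<in> {1..<int p}" using p1 by simp
    hence "f 1 \<in> {1..r}" using col by blast
    thus "r > 0" by simp
    show "[b * c = 1] (mod int p)" using b by (simp add: mult.commute)
    show "periodic_set p (A i)" for i
      unfolding periodic_def
    proof (intro allI impI)
      fix x y assume xy: "[x = y] (mod int p)"
      hence "x mod int p = y mod int p" by (simp only: cong_def)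
      with cong_dvd_iff[OF xy] show "(x \<in> A i) = (y \<in> A i)" by (simp only: A_def mem_Collect_eq)
    qed
    show "\<exists>i\<in>{1..r}. x \<in> A i" if "\<not> int p dvd x" for x
    proof
      show "x \<in> A (f (x mod int p))" using that by (simp add: A_def)
      show "f (x mod int p) \<in> {1..r}" using col range[OF that] by (rule funcset_mem)
    qed
    show "x + c * y \<notin> A i" if xy: "x \<in> A i" "y \<in> A i" for x y i
    proof
      let ?z = "x + c * y"
      assume "?z \<in> A i"
      with xy have ndvd: "\<not> int p dvd x" "\<not> int p dvd y" "\<not> int p dvd ?z"
        and cols: "f (x mod int p) = i" "f (y mod int p) = i" "f (?z mod int p) = i"
        unfolding A_def by blast+
      have "[?z mod int p = x mod int p + c * (y mod int p)] (mod int p)"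
        unfolding cong_mod_left by (intro cong_add cong_mult cong_refl) simp_all
      from free[OF ndvd[THEN range] this] cols show False by simp
    qed
  qed
  show ?thesis by (rule modulus_le_exp)
qed

section \<open>From sums in the residue ring to divisibility of integer sums\<close>

lemma finsum_residue_ring:
  assumes "m > 1" "finite S" "g \<in> S \<rightarrow> {0..m - 1}"
  shows "finsum (residue_ring m) g S = (\<Sum>j\<in>S. g j) mod m"
proof -
  interpret residues m "residue_ring m" by unfold_locales (use assms in auto)
  interpret cring "residue_ring m" by (rule cring)
  show ?thesis using assms(2,3)
  proof (induction S)
    case empty
    have "finsum (residue_ring m) g {} = \<zero>\<^bsub>residue_ring m\<^esub>" by (rule finsum_empty)
    also have "\<dots> = 0" by (simp add: residue_ring_def)
    finally show ?case by simp
  next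
    case (insert j S)
    hence "finsum (residue_ring m) g (insert j S) = g j \<oplus>\<^bsub>residue_ring m\<^esub> finsum (residue_ring m) g S"
      by (intro finsum_insert) (auto simp: residue_ring_def)
    also have "\<dots> = (g j + (\<Sum>j\<in>S. g j) mod m) mod m"
      using insert by (simp add: residue_ring_def)
    finally show ?case using insert by (simp add: mod_simps)
  qed
qed

lemma finsum_residue_ring_mult:
  assumes "m > 1" "finite S"
  shows "(\<Oplus>\<^bsub>residue_ring m\<^esub>j\<in>S. g j \<otimes>\<^bsub>residue_ring m\<^esub> h j) = (\<Sum>j\<in>S. g j * h j) mod m"
proof -
  have "(\<Oplus>\<^bsub>residue_ring m\<^esub>j\<in>S. g j \<otimes>\<^bsub>residue_ring m\<^esub> h j) = (\<Sum>j\<in>S. (g j * h j) mod m) mod m"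
    using assms by (subst finsum_residue_ring) (auto simp: residue_ring_def)
  thus ?thesis by (simp add: mod_sum_eq)
qed

lemma solution_residue_ring_iff:
  assumes "m > 1"
  shows "solution (residue_ring m) 1 n A x \<longleftrightarrow>
    x \<in> {1..n} \<rightarrow> {0..m - 1} \<and> m dvd (\<Sum>j\<in>{1..n}. A 1 j * x j)"
  unfolding solution_def finsum_residue_ring_mult[OF assms finite_atLeastAtMost]
  by (simp add: residue_ring_def dvd_eq_mod_eq_0)

text \<open>\<open>S\<close> is the first cell with a nonzero entry. All earlier entries are 0, so
  their span is trivial and the sum over the cell must vanish.\<close>

lemma columns_condition_zero_sum:
  assumes q: "q > 1" and A: "matrix_over (residue_ring q) 1 m A"
    and cc: "columns_condition (residue_ring q) 1 m A"
    and nz: "\<exists>j\<in>{1..m}. A 1 j \<noteq> 0"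
  obtains S k where "S \<subseteq> {1..m}" "k \<in> S" "A 1 k \<noteq> 0" "q dvd (\<Sum>j\<in>S. A 1 j)"
proof -
  let ?R = "residue_ring q"
  from cc obtain d and P :: "nat \<Rightarrow> nat set" where part: "partition_on {1..m} (P ` {1..d})"
    and span: "\<forall>j\<in>{1..d}. column_sum ?R 1 A (P j) \<in> column_span ?R 1 A (\<Union>k\<in>{1..<j}. P k)"
    unfolding columns_condition_def by blast
  define good where "good i \<longleftrightarrow> i \<in> {1..d} \<and> (\<exists>j\<in>P i. A 1 j \<noteq> 0)" for i
  have "\<exists>i. good i" using nz partition_onD1[OF part] by (auto simp: good_def)
  then obtain i where i: "good i" and min: "\<And>l. l < i \<Longrightarrow> \<not> good l"
    using exists_least_iff[of good] by blast
  have sub: "P l \<subseteq> {1..m}" if "l \<in> {1..d}" for l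
    using partition_onD1[OF part] that by auto
  let ?U = "\<Union>k\<in>{1..<i}. P k"
  have iD: "i \<in> {1..d}" using i by (simp add: good_def)
  have U0: "A 1 j = 0" if j: "j \<in> ?U" for j
  proof -
    from j obtain l where l: "l \<in> {1..<i}" "j \<in> P l" by blast
    hence "l \<in> {1..d}" using iD by simp
    thus ?thesis using min[of l] l by (auto simp: good_def)
  qed
  have finU: "finite ?U" using sub iD by (intro finite_UN_I finite_subset[OF sub]) auto
  have finP: "finite (P i)" using sub[OF iD] finite_subset by blast
  have "column_sum ?R 1 A (P i) \<in> column_span ?R 1 A ?U" using span iD by blast
  then obtain c where "column_sum ?R 1 A (P i) = (\<lambda>i\<in>{1..1}. \<Oplus>\<^bsub>?R\<^esub>j\<in>?U. c j \<otimes>\<^bsub>?R\<^esub> A i j)"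
    unfolding column_span_def by blast
  from fun_cong[OF this, of 1]
  have "finsum ?R (A 1) (P i) = (\<Oplus>\<^bsub>?R\<^esub>j\<in>?U. c j \<otimes>\<^bsub>?R\<^esub> A 1 j)" by (simp add: column_sum_def)
  also have "\<dots> = (\<Sum>j\<in>?U. c j * A 1 j) mod q" by (rule finsum_residue_ring_mult[OF q finU])
  also have "(\<Sum>j\<in>?U. c j * A 1 j) = 0" using U0 by (intro sum.neutral) simp
  finally have "finsum ?R (A 1) (P i) = 0" by simp
  moreover have "finsum ?R (A 1) (P i) = (\<Sum>j\<in>P i. A 1 j) mod q"
    using A sub[OF iD] by (intro finsum_residue_ring[OF q finP]) (auto simp: matrix_over_def residue_ring_def)
  ultimately have "q dvd (\<Sum>j\<in>P i. A 1 j)" by (simp add: dvd_eq_mod_eq_0)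
  moreover obtain k where "k \<in> P i" "A 1 k \<noteq> 0" using i by (auto simp: good_def)
  ultimately show ?thesis using that sub[OF iD] by blast
qed

theorem theorem1p3:
  "\<exists>C::real. C > 0 \<and>
     (\<forall>(p::nat) (m::nat) (r::nat) (A::nat \<Rightarrow> nat \<Rightarrow> int) (f::int \<Rightarrow> nat).
        prime p \<longrightarrow>
        matrix_over (residue_ring (int p)) 1 m A \<longrightarrow>
        columns_condition (residue_ring (int p)) 1 m A \<longrightarrow>
        colouring (residue_ring (int p)) r f \<longrightarrow>
        \<not> (\<exists>x. monochromatic_solution (residue_ring (int p)) 1 m A f x) \<longrightarrow>
        real p \<le> exp ((2 * real r) powr C))"
proof (intro exI[of _ 84] conjI allI impI)
  fix p m r :: nat and A :: "nat \<Rightarrow> nat \<Rightarrow> int" and f :: "int \<Rightarrow> nat"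
  let ?R = "residue_ring (int p)"
  let ?a = "A 1"
  assume prime: "prime p" and A: "matrix_over ?R 1 m A" and cc: "columns_condition ?R 1 m A"
    and col: "colouring ?R r f" and none: "\<not> (\<exists>x. monochromatic_solution ?R 1 m A f x)"
  have p1: "int p > 1" using prime_gt_1_nat[OF prime] by simp
  have no_mono: False
    if "v \<in> {1..m} \<rightarrow> {1..<int p}" "\<And>j. j \<in> {1..m} \<Longrightarrow> f (v j) = e" "int p dvd (\<Sum>j\<in>{1..m}. ?a j * v j)" for v e
  proof -
    have range: "v j \<in> {1..<int p}" if "j \<in> {1..m}" for j using \<open>v \<in> _\<close> that by blast
    have "v \<in> {1..m} \<rightarrow> {0..int p - 1}"
    proof
      fix j assume "j \<in> {1..m}"
      from range[OF this] show "v j \<in> {0..int p - 1}" by simp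
    qed
    with that(3) have "solution ?R 1 m A v"
      unfolding solution_residue_ring_iff[OF p1] by blast
    moreover have "\<forall>j\<in>{1..m}. v j \<noteq> \<zero>\<^bsub>?R\<^esub>"
    proof
      fix j assume "j \<in> {1..m}"
      from range[OF this] show "v j \<noteq> \<zero>\<^bsub>?R\<^esub>" by (simp add: residue_ring_def)
    qed
    ultimately have "monochromatic_solution ?R 1 m A f v"
      unfolding monochromatic_solution_def using that(2) by (intro conjI exI[of _ e] ballI) auto
    with none show False by blast
  qed
  \<comment> \<open>Otherwise the all-ones vector would be a monochromatic solution. This also
    excludes \<open>m = 0\<close> and the zero matrix.\<close>
  have sum_ndvd: "\<not> int p dvd (\<Sum>j\<in>{1..m}. ?a j)"
    using no_mono[of "\<lambda>_. 1" "f 1"] p1 by auto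
  hence "\<exists>j\<in>{1..m}. ?a j \<noteq> 0" by (metis dvd_0_right sum.neutral)
  from columns_condition_zero_sum[OF p1 A cc this]
  obtain S k where S: "S \<subseteq> {1..m}" "k \<in> S" "?a k \<noteq> 0" "int p dvd (\<Sum>j\<in>S. ?a j)" .
  have "k \<in> {1..m}" using S by blast
  hence "?a k \<in> {0..int p - 1}" using A by (auto simp: matrix_over_def residue_ring_def)
  hence ak: "\<not> int p dvd ?a k" using S(3) by (auto dest: zdvd_imp_le)
  define b where "b = (\<Sum>j\<in>{1..m} - S. ?a j)"
  have "(\<Sum>j\<in>{1..m}. ?a j) = b + (\<Sum>j\<in>S. ?a j)"
    unfolding b_def using S(1) by (intro sum.subset_diff) auto
  hence b: "\<not> int p dvd b" using sum_ndvd S(4) by (metis dvd_add)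
  have prime': "prime (int p)" using prime by simp
  have "coprime (int p) (?a k)" using prime' ak by (rule prime_imp_coprime)
  hence "coprime (?a k) (int p)" by (simp only: coprime_commute)
  then obtain a' where a': "[?a k * a' = 1] (mod int p)" using cong_solve_coprime_int by blast
  \<comment> \<open>Dividing the reduced equation by \<open>?a k\<close> gives
    \<open>z = x + c * y\<close> with \<open>c = - (a' * b)\<close>, which is nonzero since
    \<open>a'\<close> and \<open>b\<close> are.\<close>
  have c: "\<not> int p dvd - (a' * b)"
  proof
    assume "int p dvd - (a' * b)"
    hence "int p dvd a'" using b prime' by (simp add: prime_dvd_mult_iff)
    hence "[0 = ?a k * a'] (mod int p)" by (simp add: cong_def)
    from cong_trans[OF this a'] p1 show False by (simp add: cong_def)
  qed
  have "real p \<le> exp ((2 * real r) ^ 84)"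
  proof (rule sum_free_modulus_le[OF prime c])
    show "f \<in> {1..<int p} \<rightarrow> {1..r}"
      using col by (auto simp: colouring_def residue_ring_def Pi_iff)
    fix x y z
    assume xyz: "x \<in> {1..<int p}" "y \<in> {1..<int p}" "z \<in> {1..<int p}"
      and eq: "[z = x + - (a' * b) * y] (mod int p)" and mono: "f x = f y" "f x = f z"
    \<comment> \<open>The coefficients on \<open>S\<close> sum to zero, so \<open>x\<close> cancels
      there up to the correction \<open>?a k * (z - x)\<close> at the column
      \<open>k\<close>.\<close>
    define v where "v j = (if j = k then z else if j \<in> S then x else y)" for j
    have "(\<Sum>j\<in>{1..m}. ?a j * v j) = (\<Sum>j\<in>{1..m} - S. ?a j * v j) + (\<Sum>j\<in>S. ?a j * v j)"
      using S(1) by (intro sum.subset_diff) auto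
    also have "(\<Sum>j\<in>{1..m} - S. ?a j * v j) = b * y"
      unfolding b_def sum_distrib_right by (intro sum.cong) (use S in \<open>auto simp: v_def\<close>)
    also have "(\<Sum>j\<in>S. ?a j * v j) = (\<Sum>j\<in>S. ?a j * x + (if j = k then ?a k * (z - x) else 0))"
      by (intro sum.cong) (auto simp: v_def algebra_simps)
    also have "\<dots> = (\<Sum>j\<in>S. ?a j) * x + ?a k * (z - x)"
      using S(1,2) finite_subset[OF S(1)] by (simp add: sum.distrib sum_distrib_right)
    finally have total: "(\<Sum>j\<in>{1..m}. ?a j * v j) = b * y + ((\<Sum>j\<in>S. ?a j) * x + ?a k * (z - x))" .
    have "[?a k * (z - x) = ?a k * ((x + - (a' * b) * y) - x)] (mod int p)"
      by (intro cong_mult cong_diff cong_refl eq)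
    also have "?a k * ((x + - (a' * b) * y) - x) = (?a k * a') * (- (b * y))" by (simp add: algebra_simps)
    also have "[(?a k * a') * (- (b * y)) = 1 * (- (b * y))] (mod int p)"
      by (intro cong_mult a' cong_refl)
    finally have "int p dvd ?a k * (z - x) + b * y" by (simp add: cong_iff_dvd_diff)
    with S(4) have "int p dvd (\<Sum>j\<in>S. ?a j) * x + (?a k * (z - x) + b * y)"
      by (rule dvd_add[OF dvd_mult2])
    hence "int p dvd (\<Sum>j\<in>{1..m}. ?a j * v j)"
      unfolding total by (simp only: ac_simps)
    moreover have "v \<in> {1..m} \<rightarrow> {1..<int p}" "\<And>j. f (v j) = f x"
      using xyz mono by (auto simp: v_def)
    ultimately show False by (intro no_mono[of v "f x"])
  qed
  moreover have "0 < r"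
  proof -
    have "f 1 \<in> {1..r}" using col p1 by (auto simp: colouring_def residue_ring_def Pi_iff)
    thus ?thesis by simp
  qed
  ultimately show "real p \<le> exp ((2 * real r) powr 84)" by (simp add: powr_numeral)
qed simp

end
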